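(* Let $g,h\in\mathbb{N}$, $G\in\mathcal{H}$, and let $p$ be the constant such that $\#R_G(X)=pX+O(E(X))$ as $X\to\infty$ (so $p=\lim_{X\to\infty}\#R_G(X)/X$). (1) Let $(g,h)=(2,1)$. Then $G$ has the unique expansion property under $\mathcal{E}$ if and only if $(G_1,G_2)$ does not belong to the set $I:=\{(1,2),(2,1),(3,2),(3,1),(4,1),(5,1)\}$. If $(G_1,G_2)\in I$, then $p=1$, i.e., $\#R_G(X)=X+O(1)$, and if $(G_1,G_2)\notin I$, then $p=r$. (2) Let $(g,h)=(1,2)$. Then $G$ has the unique expansion property under $\mathcal{E}$ if and only if $(G_1,G_2)$ does not belong to the set $I:=\{(2,1),(3,1)\}$. If $(G_1,G_2)=(2,1)$, then $p=5/6$, and if $(G_1,G_2)=(3,1)$, then $p=11/16$. Finally, if $(G_1,G_2)\notin I$, then $p=r$. (3) Let $(g,h)=(1,3)$. Then $G$ has the unique expansion property under $\mathcal{E}$ if and only if $(G_1,G_2)$ does not belong to the set $I:=\{(2,1),(3,1),(4,1)\}$. If $(G_1,G_2)\in I$, then $$(G_1,G_2)=(2,1)\Rightarrow p=\tfrac1{13}(9+2\omega)\approx0.7591,$$ $$(G_1,G_2)=(3,1)\Rightarrow p=\tfrac1{87}(41+25\omega)\approx0.5961,$$ $$(G_1,G_2)=(4,1)\Rightarrow p=\tfrac1{153}(55+50\omega)\approx0.5014.$$ If $(G_1,G_2)\notin I$, then $p=r$.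
   Context: $\mathbb{N}$ is the set of positive integers and $\mathbb{N}_0=\mathbb{N}\cup\{0\}$. Given $g,h\in\mathbb{N}$, $\mathcal{H}$ is the collection of sequences $G=(G_k)_{k\ge1}$ of positive integers such that $G_{k+2}=gG_{k+1}+hG_k$ for all $k\in\mathbb{N}$ and $G_1,G_2$ are distinct and coprime. A coefficient tuple is an infinite tuple $\epsilon=(\epsilon_1,\epsilon_2,\dots)$ of non-negative integers with only finitely many nonzero entries; a finite tuple is identified with an infinite one by appending zeros. Put $\epsilon\cdot G:=\sum_{k\ge1}\epsilon_kG_k$. The semi-proper blocks are the finite tuples $(c)$ with $0\le c\le g-1$ and $(c,g)$ with $0\le c\le h-1$. $\mathcal{E}_{\mathrm p}$ is the set of tuples obtained by concatenating (finitely many) semi-proper blocks; $\mathcal{E}_{\mathrm m}$ is the set of tuples $(g,\epsilon_2,\dots,\epsilon_\ell)$ with $(\epsilon_2,\dots,\epsilon_\ell)\in\mathcal{E}_{\mathrm p}$; $\mathcal{E}:=\mathcal{E}_{\mathrm p}\cup\mathcal{E}_{\mathrm m}$. $G$ has the unique expansion property under $\mathcal{E}$ if the map $\mathcal{E}\to\mathbb{N}_0$, $\epsilon\mapsto\epsilon\cdot G$, is injective. $R_G$ is the set of $n\in\mathbb{N}$ with $n=\epsilon\cdot G$ for some $\epsilon\in\mathcal{E}$, and $R_G(X):=\{n\in R_G:n\le X\}$ for $X\in\mathbb{N}$. $\alpha>1$ and $\beta$ are the two real zeros of $x^2-gx-h$; $\omega:=1/\alpha$; $\beta_0:=|\beta|$;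 $r:=\frac{(g+1)\alpha+h}{G_2\alpha+hG_1}$. $E(X)=1$ if $\beta_0<1$, $E(X)=\ln X$ if $\beta_0=1$, and $E(X)=X^{\gamma}$ with $\gamma=\log_\alpha\beta_0<1$ if $\beta_0>1$. It is known that for every $G\in\mathcal{H}$ a constant $p$ with $\#R_G(X)=pX+O(E(X))$ exists. *)

theory Defs
  imports Complex_Main "HOL-Library.Landau_Symbols"
begin

text \<open>
  Sequences and coefficient tuples are indexed from 1. Both are functions on \<^typ>\<open>nat\<close>;
  the value \<open>G 0\<close> of a sequence is never used, and a coefficient tuple is always 0 at index 0,
  so that distinct functions represent distinct tuples.
\<close>

definition rec_seqs :: "nat \<Rightarrow> nat \<Rightarrow> (nat \<Rightarrow> nat) set" where
  "rec_seqs g h = {G. (\<forall>k\<ge>1. G k > 0) \<and> (\<forall>k\<ge>1. G (k + 2) = g * G (k + 1) + h * G k) \<and>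
                      G 1 \<noteq> G 2 \<and> coprime (G 1) (G 2)}"

definition tuple :: "nat list \<Rightarrow> nat \<Rightarrow> nat" where
  "tuple cs k = (if 1 \<le> k \<and> k \<le> length cs then cs ! (k - 1) else 0)"

definition eval_tuple :: "(nat \<Rightarrow> nat) \<Rightarrow> (nat \<Rightarrow> nat) \<Rightarrow> nat" where
  "eval_tuple \<epsilon> G = (\<Sum>k | k \<ge> 1 \<and> \<epsilon> k \<noteq> 0. \<epsilon> k * G k)"

text \<open>
  For positive \<open>g\<close> and \<open>h\<close>, \<open>c < g\<close> and \<open>c < h\<close> are \<open>c \<le> g - 1\<close> and \<open>c \<le> h - 1\<close>.
\<close>

definition semi_proper_blocks :: "nat \<Rightarrow> nat \<Rightarrow> nat list set" where
  "semi_proper_blocks g h = {[c] | c. c < g} \<union> {[c, g] | c. c < h}"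

definition block_concats :: "nat \<Rightarrow> nat \<Rightarrow> nat list set" where
  "block_concats g h = {concat bs | bs. set bs \<subseteq> semi_proper_blocks g h}"

definition coeffs_p :: "nat \<Rightarrow> nat \<Rightarrow> (nat \<Rightarrow> nat) set" where
  "coeffs_p g h = {tuple cs | cs. cs \<in> block_concats g h}"

definition coeffs_m :: "nat \<Rightarrow> nat \<Rightarrow> (nat \<Rightarrow> nat) set" where
  "coeffs_m g h = {tuple (g # cs) | cs. cs \<in> block_concats g h}"

definition coeffs :: "nat \<Rightarrow> nat \<Rightarrow> (nat \<Rightarrow> nat) set" where
  "coeffs g h = coeffs_p g h \<union> coeffs_m g h"

definition unique_expansion :: "nat \<Rightarrow> nat \<Rightarrow> (nat \<Rightarrow> nat) \<Rightarrow> bool" where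
  "unique_expansion g h G \<longleftrightarrow> inj_on (\<lambda>\<epsilon>. eval_tuple \<epsilon> G) (coeffs g h)"

definition represented :: "nat \<Rightarrow> nat \<Rightarrow> (nat \<Rightarrow> nat) \<Rightarrow> nat set" where
  "represented g h G = {n. n \<ge> 1 \<and> (\<exists>\<epsilon>\<in>coeffs g h. n = eval_tuple \<epsilon> G)}"

definition represented_upto :: "nat \<Rightarrow> nat \<Rightarrow> (nat \<Rightarrow> nat) \<Rightarrow> nat \<Rightarrow> nat set" where
  "represented_upto g h G X = {n \<in> represented g h G. n \<le> X}"

definition alpha :: "nat \<Rightarrow> nat \<Rightarrow> real" where
  "alpha g h = (real g + sqrt (real g ^ 2 + 4 * real h)) / 2"

definition beta :: "nat \<Rightarrow> nat \<Rightarrow> real" where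
  "beta g h = (real g - sqrt (real g ^ 2 + 4 * real h)) / 2"

lemma alpha_beta_zeros: "{x. x ^ 2 - real g * x - real h = 0} = {alpha g h, beta g h}"
proof -
  have s: "sqrt (real g ^ 2 + 4 * real h) ^ 2 = real g ^ 2 + 4 * real h"
    by simp
  have "x ^ 2 - real g * x - real h = (x - alpha g h) * (x - beta g h)" for x
    using s unfolding alpha_def beta_def by (simp add: field_simps power2_eq_square)
  then show ?thesis
    by auto
qed

lemma alpha_gt_1:
  assumes "g \<ge> 1" "h \<ge> 1"
  shows "alpha g h > 1"
proof -
  have "sqrt (real g ^ 2 + 4 * real h) > sqrt 1"
    using assms zero_le_power2[of "real g"] by (intro real_sqrt_less_mono) linarith
  then have "2 < real g + sqrt (real g ^ 2 + 4 * real h)"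
    using assms unfolding real_sqrt_one by linarith
  then show ?thesis
    by (simp add: alpha_def)
qed

definition omega :: "nat \<Rightarrow> nat \<Rightarrow> real" where
  "omega g h = 1 / alpha g h"

definition beta0 :: "nat \<Rightarrow> nat \<Rightarrow> real" where
  "beta0 g h = \<bar>beta g h\<bar>"

definition rho :: "nat \<Rightarrow> nat \<Rightarrow> (nat \<Rightarrow> nat) \<Rightarrow> real" where
  "rho g h G = ((real g + 1) * alpha g h + real h) / (real (G 2) * alpha g h + real h * real (G 1))"

definition err :: "nat \<Rightarrow> nat \<Rightarrow> nat \<Rightarrow> real" where
  "err g h X = (if beta0 g h < 1 then 1
                else if beta0 g h = 1 then ln (real X)
                else real X powr log (alpha g h) (beta0 g h))"

end

theory Submission
  imports Defs
begin

text \<open>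
  Order the tuples of length at most \<open>k\<close> by their values for the sequence \<open>1, g + 1, ...\<close> in
  \<open>\<H>\<close>. Passing to the next tuple raises one digit and erases a maximal tail below it, and for any
  \<open>G\<close> the gap between \<open>G\<^bsub>k+1\<^esub>\<close> and the value of the maximal tuple of length \<open>k\<close> is either
  \<open>a = G\<^sub>1\<close> or \<open>b = G\<^sub>2 - g G\<^sub>1\<close>, according to the parity of \<open>k\<close>. Hence the values of all tuples,
  listed in this order, are the partial sums \<open>\<phi>(0), \<phi>(1), ...\<close> of one infinite word in the letters
  \<open>a, b\<close>, the fixed point of \<open>a \<mapsto> a\<^sup>g b\<close>, \<open>b \<mapsto> a\<^sup>h\<close>. The word depends only on \<open>(g, h)\<close>; the sequence
  \<open>G\<close> enters through the numbers \<open>a\<close> and \<open>b\<close> alone. Lemmas \<open>unique_expansion_iff\<close> and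
  \<open>represented_iff\<close> translate the problem: unique expansion means that \<open>\<phi>\<close> is injective, and the
  represented numbers are the positive values of \<open>\<phi>\<close>.

  A collision \<open>\<phi>(n) = \<phi>(n')\<close> is a factor of the word with weight zero. If it contains \<open>i\<close> letters
  \<open>a\<close> and \<open>j\<close> letters \<open>b\<close>, then \<open>(g j - i) G\<^sub>1 = j G\<^sub>2\<close>, so \<open>i < g j\<close> and, by coprimality, the pair
  \<open>(i, j)\<close> determines \<open>(G\<^sub>1, G\<^sub>2)\<close>. In the three cases \<open>b\<close> is so rare that \<open>i < g j\<close> holds only for
  short factors. All factors of a given length already occur in an initial piece of the word, so
  inspecting finitely many windows gives all exceptional pairs (\<open>collision\<close>).

  For the density, \<open>\<phi>(n)\<close> is asymptotic to \<open>n / r\<close> (\<open>phi_near_linear\<close>), so \<open>p = r\<close> when \<open>\<phi>\<close> is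
  injective (\<open>density_if_unique\<close>). Otherwise count each value at its last visit. Whether
  \<open>n\<close> is a last visit depends on the next few letters only, because collisions are short. The
  number of last visits inside the \<open>k\<close>-th block of the word therefore satisfies the linear
  recurrence of \<open>G\<close>, and two counts made by computation give \<open>p\<close> in closed form
  (\<open>density_if_short_collisions\<close>).
\<close>

section \<open>The word of increments\<close>

text \<open>
  The letter \<open>a\<close> is \<open>False\<close> and \<open>b\<close> is \<open>True\<close>. The list \<open>block g h k\<close> is the \<open>k\<close>-th image of \<open>a\<close> under
  \<open>a \<mapsto> a\<^sup>g b\<close>, \<open>b \<mapsto> a\<^sup>h\<close>. Each block is a prefix of the next one, so the blocks converge to an infinite
  word.
\<close>

fun block :: "nat \<Rightarrow> nat \<Rightarrow> nat \<Rightarrow> bool list" where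
  "block g h 0 = [False]"
| "block g h (Suc 0) = replicate g False @ [True]"
| "block g h (Suc (Suc k)) =
     concat (replicate g (block g h (Suc k))) @ concat (replicate h (block g h k))"

text \<open>
  Since the \<open>n\<close>-th block has more than \<open>n\<close> letters, it determines the letter at position \<open>n\<close> of the
  infinite word.
\<close>

definition letter :: "nat \<Rightarrow> nat \<Rightarrow> nat \<Rightarrow> bool" where
  "letter g h n = block g h n ! n"

definition letter_weight :: "int \<Rightarrow> int \<Rightarrow> bool \<Rightarrow> int" where
  "letter_weight a b x = (if x then b else a)"

definition weight :: "int \<Rightarrow> int \<Rightarrow> bool list \<Rightarrow> int" where
  "weight a b xs = sum_list (map (letter_weight a b) xs)"

fun prefix_weights :: "int \<Rightarrow> int \<Rightarrow> bool list \<Rightarrow> int list" where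
  "prefix_weights a b [] = []"
| "prefix_weights a b (x # xs) = 0 # map (\<lambda>v. v + letter_weight a b x) (prefix_weights a b xs)"

text \<open>
  All digit lists of length \<open>k\<close> that represent tuples in \<open>\<E>\<close> after padding with zeros. The
  recursion splits off the block that carries the top digits. A leading digit \<open>g\<close> is allowed
  at length 1, and this accounts for \<open>\<E>\<^sub>m\<close>. The order of the list is that of the values for the
  sequence \<open>1, g + 1, ...\<close>, which makes the lists match the partial sums of the blocks entry by entry.
\<close>

fun expansions :: "nat \<Rightarrow> nat \<Rightarrow> nat \<Rightarrow> nat list list" where
  "expansions g h 0 = [[]]"
| "expansions g h (Suc 0) = map (\<lambda>c. [c]) [0..<Suc g]"
| "expansions g h (Suc (Suc k)) =
     concat (map (\<lambda>c. map (\<lambda>cs. cs @ [c]) (expansions g h (Suc k))) [0..<g])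
   @ concat (map (\<lambda>c. map (\<lambda>cs. cs @ [c, g]) (expansions g h k)) [0..<h])"

definition eval_digits :: "(nat \<Rightarrow> nat) \<Rightarrow> nat list \<Rightarrow> nat" where
  "eval_digits G cs = (\<Sum>i<length cs. cs ! i * G (Suc i))"

lemma weight_simps [simp]:
  "weight a b [] = 0" "weight a b (x # xs) = letter_weight a b x + weight a b xs"
  "weight a b (xs @ ys) = weight a b xs + weight a b ys"
  by (simp_all add: weight_def)

lemma weight_replicate [simp]:
  "weight a b (replicate n x) = int n * letter_weight a b x"
  "weight a b (concat (replicate n xs)) = int n * weight a b xs"
  by (induction n) (auto simp: algebra_simps)

lemma length_prefix_weights [simp]: "length (prefix_weights a b xs) = length xs"
  by (induction xs) auto

lemma prefix_weights_append:
  "prefix_weights a b (xs @ ys) = prefix_weights a b xs @ map (\<lambda>v. v + weight a b xs) (prefix_weights a b ys)"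
  by (induction xs) (auto simp: o_def algebra_simps)

lemma nth_prefix_weights: "i < length xs \<Longrightarrow> prefix_weights a b xs ! i = weight a b (take i xs)"
proof (induction xs arbitrary: i)
  case (Cons x xs)
  then show ?case by (cases i) auto
qed auto

lemma prefix_weights_concat_replicate:
  "prefix_weights a b (concat (replicate n xs)) =
     concat (map (\<lambda>c. map (\<lambda>v. v + int c * weight a b xs) (prefix_weights a b xs)) [0..<n])"
proof (induction n)
  case (Suc n)
  have "concat (replicate (Suc n) xs) = concat (replicate n xs) @ xs"
    by (induction n) auto
  then show ?case
    using Suc by (simp add: prefix_weights_append)
qed auto

lemma prefix_weights_replicate: "prefix_weights a b (replicate n x) = map (\<lambda>c. int c * letter_weight a b x) [0..<n]"
  by (rule nth_equalityI) (auto simp: nth_prefix_weights min_def)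

lemma length_concat_replicate [simp]: "length (concat (replicate n xs)) = n * length xs"
  by (induction n) auto

lemma prefix_weights_one: "prefix_weights 1 1 xs = map int [0..<length xs]"
proof (rule nth_equalityI)
  have *: "weight 1 1 ys = int (length ys)" for ys
    by (induction ys) (auto simp: letter_weight_def)
  show "prefix_weights 1 1 xs ! i = map int [0..<length xs] ! i" if "i < length (prefix_weights 1 1 xs)" for i
    using that by (simp add: nth_prefix_weights *)
qed simp

lemma eval_digits_snoc: "eval_digits G (cs @ [c]) = eval_digits G cs + c * G (Suc (length cs))"
proof -
  have "(\<Sum>i<length cs. (cs @ [c]) ! i * G (Suc i)) = (\<Sum>i<length cs. cs ! i * G (Suc i))"
    by (intro sum.cong) (auto simp: nth_append)
  then show ?thesis
    by (simp add: eval_digits_def)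
qed

lemma eval_digits_snoc2:
  "eval_digits G (cs @ [c, d]) = eval_digits G cs + c * G (Suc (length cs)) + d * G (Suc (Suc (length cs)))"
  using eval_digits_snoc[of G "cs @ [c]" d] eval_digits_snoc[of G cs c] by simp

lemma length_expansions: "cs \<in> set (expansions g h k) \<Longrightarrow> length cs = k"
  by (induction g h k arbitrary: cs rule: expansions.induct) (fastforce)+

definition recurrent :: "nat \<Rightarrow> nat \<Rightarrow> (nat \<Rightarrow> nat) \<Rightarrow> bool" where
  "recurrent g h G \<longleftrightarrow> (\<forall>k\<ge>1. G (k + 2) = g * G (k + 1) + h * G k)"

lemma recurrentD: "recurrent g h G \<Longrightarrow> G (Suc (Suc (Suc k))) = g * G (Suc (Suc k)) + h * G (Suc k)"
  unfolding recurrent_def by (metis One_nat_def Suc_eq_plus1 add_2_eq_Suc' le_add2)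

text \<open>
  With \<open>a = G\<^sub>1\<close> and \<open>b = G\<^sub>2 - g G\<^sub>1\<close> the first two blocks have weights \<open>G\<^sub>1\<close> and \<open>G\<^sub>2\<close>; concatenation of
  blocks then repeats the recurrence of \<open>G\<close>.
\<close>

lemma weight_block:
  assumes "recurrent g h G"
  shows "weight (int (G 1)) (int (G 2) - int g * int (G 1)) (block g h k) = int (G (Suc k))"
proof (induction k rule: induct_nat_012)
  case (ge2 k)
  then show ?case
    by (simp add: recurrentD[OF assms])
qed (auto simp: letter_weight_def eval_nat_numeral)

text \<open>
  The link between tuples and the word. A digit \<open>c\<close> in front of \<open>G\<^bsub>k+2\<^esub>\<close> shifts the list of values
  by \<open>c\<close> times the weight of a block, exactly as the partial sums of a concatenation are those of
  its parts, shifted.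
\<close>

lemma weights_of_expansions:
  assumes "recurrent g h G"
  shows "map (\<lambda>cs. int (eval_digits G cs)) (expansions g h k) =
           prefix_weights (int (G 1)) (int (G 2) - int g * int (G 1)) (block g h k)"
proof (induction k rule: induct_nat_012)
  case 0
  show ?case by (simp add: eval_digits_def)
next
  case 1
  show ?case
    by (simp add: prefix_weights_append prefix_weights_replicate letter_weight_def eval_digits_def)
next
  case (ge2 k)
  let ?ps = "prefix_weights (int (G 1)) (int (G 2) - int g * int (G 1))"
  have 1: "map (\<lambda>cs. int (eval_digits G (cs @ [c]))) (expansions g h (Suc k)) =
        map (\<lambda>v. v + int c * int (G (Suc (Suc k)))) (?ps (block g h (Suc k)))" for c
    unfolding ge2(2)[symmetric] by (auto simp: eval_digits_snoc length_expansions)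
  have 2: "map (\<lambda>cs. int (eval_digits G (cs @ [c, g]))) (expansions g h k) =
        map (\<lambda>v. v + int c * int (G (Suc k)) + int g * int (G (Suc (Suc k)))) (?ps (block g h k))" for c
    unfolding ge2(1)[symmetric] by (auto simp: eval_digits_snoc2 length_expansions)
  show ?case
    using weight_block[OF assms, of k] weight_block[OF assms, of "Suc k"]
    by (simp add: prefix_weights_append prefix_weights_concat_replicate map_concat o_def 1 2 add_ac)
qed

locale numeration =
  fixes g h :: nat
  assumes g_pos: "g \<ge> 1" and h_pos: "h \<ge> 1"
begin

abbreviation W :: "nat \<Rightarrow> bool list" where
  "W \<equiv> block g h"

abbreviation N :: "nat \<Rightarrow> nat" where
  "N k \<equiv> length (W k)"

abbreviation w :: "nat \<Rightarrow> bool" where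
  "w \<equiv> letter g h"

text \<open>
  The path whose steps are the letters of the infinite word. Its values are the values of all tuples.
\<close>

definition phi :: "int \<Rightarrow> int \<Rightarrow> nat \<Rightarrow> int" where
  "phi a b n = (\<Sum>i<n. letter_weight a b (w i))"

lemma block_prefix_Suc: "\<exists>zs. W (Suc k) = W k @ zs"
proof -
  obtain g' where "g = Suc g'"
    using g_pos by (cases g) auto
  then show ?thesis
    by (cases k) auto
qed

lemma block_prefix: "k \<le> l \<Longrightarrow> \<exists>zs. W l = W k @ zs"
proof (induction l rule: dec_induct)
  case (step l)
  then show ?case
    using block_prefix_Suc[of l] by auto
qed auto

lemma N_pos: "N k > 0"
  using block_prefix[of 0 k] by auto

lemma N_rec: "N (Suc (Suc k)) = g * N (Suc k) + h * N k"
  by simp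

lemma N_less_Suc: "N k < N (Suc k)"
proof (cases k)
  case (Suc j)
  have "N k \<le> g * N k" "0 < h * N j"
    using g_pos h_pos N_pos[of j] by auto
  then show ?thesis
    unfolding Suc N_rec by linarith
qed (use g_pos in auto)

lemma less_N: "k < N k"
proof (induction k)
  case (Suc k)
  then show ?case using N_less_Suc[of k] by linarith
qed auto

lemma letter_eq_nth: "i < N k \<Longrightarrow> w i = W k ! i"
  using block_prefix[of k i] block_prefix[of i k] less_N[of i]
  unfolding letter_def by (cases "k \<le> i") (auto simp: nth_append)

lemma map_letter_block: "map w [0..<N k] = W k"
  by (rule nth_equalityI) (auto simp: letter_eq_nth)

lemma map_letter_take: "n \<le> N k \<Longrightarrow> map w [0..<n] = take n (W k)"
  by (subst map_letter_block[symmetric]) (simp add: take_map)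

lemma phi_diff: "n \<le> m \<Longrightarrow> phi a b m - phi a b n = weight a b (map w [n..<m])"
  by (induction m rule: dec_induct) (auto simp: phi_def)

lemma phi_eq_weight: "phi a b n = weight a b (map w [0..<n])"
  using phi_diff[of 0 n a b] by (simp add: phi_def)

lemma prefix_weights_block: "prefix_weights a b (W k) = map (phi a b) [0..<N k]"
  by (rule nth_equalityI) (auto simp: nth_prefix_weights phi_eq_weight map_letter_take[symmetric])

text \<open>
  The block lengths form the sequence with \<open>a = b = 1\<close>, for which the partial sums are the natural
  numbers in order. So this sequence numbers the tuples without repetition.
\<close>

lemma eval_digits_N_expansions: "map (eval_digits (\<lambda>i. N (i - 1))) (expansions g h k) = [0..<N k]"
proof -
  have "recurrent g h (\<lambda>i. N (i - 1))"
    unfolding recurrent_def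
  proof (intro allI impI)
    fix k :: nat assume "k \<ge> 1"
    then obtain j where "k = Suc j" by (cases k) auto
    then show "N (k + 2 - 1) = g * N (k + 1 - 1) + h * N (k - 1)" by simp
  qed
  from weights_of_expansions[OF this, of k]
  have "map int (map (eval_digits (\<lambda>i. N (i - 1))) (expansions g h k)) = map int [0..<N k]"
    by (simp add: prefix_weights_one o_def eval_nat_numeral)
  then show ?thesis
    by (metis inj_map_eq_map inj_of_nat)
qed

lemma eval_digits_expansions:
  assumes "recurrent g h G"
  shows "map (\<lambda>cs. int (eval_digits G cs)) (expansions g h k) =
           map (phi (int (G 1)) (int (G 2) - int g * int (G 1))) [0..<N k]"
  using weights_of_expansions[OF assms] by (simp add: prefix_weights_block)

end

section \<open>Tuples and positions in the word\<close>

context numeration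
begin

lemma snoc_expansions: "cs \<in> set (expansions g h k) \<Longrightarrow> c < g \<Longrightarrow> cs @ [c] \<in> set (expansions g h (Suc k))"
  by (cases k) auto

lemma snoc2_expansions:
  "cs \<in> set (expansions g h k) \<Longrightarrow> c < h \<Longrightarrow> cs @ [c, g] \<in> set (expansions g h (Suc (Suc k)))"
  by auto

lemma append_blocks_expansions:
  assumes "cs \<in> set (expansions g h k)" "set bs \<subseteq> semi_proper_blocks g h"
  shows "cs @ concat bs \<in> set (expansions g h (k + length (concat bs)))"
  using assms(2)
proof (induction bs rule: rev_induct)
  case (snoc b bs)
  then have IH: "cs @ concat bs \<in> set (expansions g h (k + length (concat bs)))"
    and "b \<in> semi_proper_blocks g h" by auto
  then consider c where "b = [c]" "c < g" | c where "b = [c, g]" "c < h"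
    by (auto simp: semi_proper_blocks_def)
  then show ?case
    using snoc_expansions[OF IH] snoc2_expansions[OF IH] by cases auto
qed (use assms(1) in auto)

lemma block_concats_snoc:
  assumes "cs \<in> block_concats g h" "b \<in> semi_proper_blocks g h"
  shows "cs @ b \<in> block_concats g h"
proof -
  obtain bs where "cs = concat bs" "set bs \<subseteq> semi_proper_blocks g h"
    using assms(1) by (auto simp: block_concats_def)
  then show ?thesis
    using assms(2) by (auto simp: block_concats_def intro!: exI[of _ "bs @ [b]"])
qed

lemma expansions_subset:
  "set (expansions g h k) \<subseteq> block_concats g h \<union> (#) g ` block_concats g h"
proof (induction k rule: induct_nat_012)
  case 0
  show ?case by (auto simp: block_concats_def intro!: exI[of _ "[]"])
next
  case 1
  have "[] \<in> block_concats g h"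
    by (auto simp: block_concats_def intro!: exI[of _ "[]"])
  moreover have "[c] \<in> block_concats g h" if "c < g" for c
    using block_concats_snoc[OF calculation, of "[c]"] that by (auto simp: semi_proper_blocks_def)
  ultimately show ?case
    by auto
next
  case (ge2 k)
  let ?E = "block_concats g h \<union> (#) g ` block_concats g h"
  have snoc: "cs @ b \<in> ?E" if "cs \<in> ?E" "b \<in> semi_proper_blocks g h" for cs b
    using that block_concats_snoc by auto
  have b: "[c] \<in> semi_proper_blocks g h" if "c < g" for c
    using that by (auto simp: semi_proper_blocks_def)
  have b2: "[c, g] \<in> semi_proper_blocks g h" if "c < h" for c
    using that by (auto simp: semi_proper_blocks_def)
  show ?case
  proof
    fix ds assume "ds \<in> set (expansions g h (Suc (Suc k)))"
    then consider c cs where "ds = cs @ [c]" "c < g" "cs \<in> set (expansions g h (Suc k))"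
      | c cs where "ds = cs @ [c, g]" "c < h" "cs \<in> set (expansions g h k)"
      by auto
    then show "ds \<in> ?E"
      using ge2 snoc b b2 by cases blast+
  qed
qed

lemma coeffs_eq: "coeffs g h = (\<Union>k. tuple ` set (expansions g h k))"
proof
  have "tuple cs \<in> (\<Union>k. tuple ` set (expansions g h k))"
    if "cs \<in> block_concats g h \<union> (#) g ` block_concats g h" for cs
  proof -
    from that obtain bs where bs: "set bs \<subseteq> semi_proper_blocks g h"
      and "cs = concat bs \<or> cs = g # concat bs"
      by (auto simp: block_concats_def)
    with append_blocks_expansions[OF _ bs, of "[]" 0] append_blocks_expansions[OF _ bs, of "[g]" 1]
    show ?thesis by auto
  qed
  then show "coeffs g h \<subseteq> (\<Union>k. tuple ` set (expansions g h k))"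
    unfolding coeffs_def coeffs_p_def coeffs_m_def by blast
  show "(\<Union>k. tuple ` set (expansions g h k)) \<subseteq> coeffs g h"
    using expansions_subset unfolding coeffs_def coeffs_p_def coeffs_m_def by blast
qed

lemma tuple_append_0: "tuple (cs @ [0]) = tuple cs"
  by (auto simp: tuple_def fun_eq_iff nth_append)

lemma tuple_expansions_mono:
  "k \<le> l \<Longrightarrow> tuple ` set (expansions g h k) \<subseteq> tuple ` set (expansions g h l)"
proof (induction l rule: dec_induct)
  case (step l)
  have "tuple ` set (expansions g h l) \<subseteq> tuple ` set (expansions g h (Suc l))"
  proof
    fix e assume "e \<in> tuple ` set (expansions g h l)"
    then obtain cs where "e = tuple (cs @ [0])" "cs \<in> set (expansions g h l)"
      by (auto simp: tuple_append_0)
    then show "e \<in> tuple ` set (expansions g h (Suc l))"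
      using snoc_expansions[of cs l 0] g_pos by auto
  qed
  with step show ?case by blast
qed auto

lemma eval_tuple_eq_eval_digits: "eval_tuple (tuple cs) G = eval_digits G cs"
proof -
  have "eval_tuple (tuple cs) G = (\<Sum>k\<in>{1..length cs}. tuple cs k * G k)"
    unfolding eval_tuple_def
    by (rule sum.mono_neutral_left) (auto simp: tuple_def split: if_splits)
  also have "\<dots> = (\<Sum>i<length cs. cs ! i * G (Suc i))"
    by (rule sum.reindex_bij_witness[of _ Suc "\<lambda>i. i - 1"]) (auto simp: tuple_def)
  finally show ?thesis by (simp add: eval_digits_def)
qed

lemma tuple_inject:
  assumes "tuple cs = tuple ds" "length cs = length ds"
  shows "cs = ds"
proof (rule nth_equalityI)
  show "cs ! i = ds ! i" if "i < length cs" for i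
    using fun_cong[OF assms(1), of "Suc i"] assms(2) that by (simp add: tuple_def)
qed (use assms in simp)

lemma length_expansions_eq: "length (expansions g h k) = N k"
  using arg_cong[OF eval_digits_N_expansions[of k], of length] by simp

lemma length_nth_expansions: "n < N k \<Longrightarrow> length (expansions g h k ! n) = k"
  using length_expansions[of "expansions g h k ! n" g h k] length_expansions_eq[of k] by simp

lemma distinct_expansions: "distinct (expansions g h k)"
  using eval_digits_N_expansions[of k] by (metis distinct_map distinct_upt)

lemma eval_digits_nth_expansions:
  assumes "recurrent g h G" "n < N k"
  shows "int (eval_digits G (expansions g h k ! n)) = phi (int (G 1)) (int (G 2) - int g * int (G 1)) n"
  using arg_cong[OF eval_digits_expansions[OF assms(1), of k], of "\<lambda>xs. xs ! n"] assms(2)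
  by (simp add: length_expansions_eq)

lemma unique_expansion_iff:
  assumes "recurrent g h G"
  shows "unique_expansion g h G \<longleftrightarrow> inj (phi (int (G 1)) (int (G 2) - int g * int (G 1)))"
    (is "_ \<longleftrightarrow> inj ?f")
proof
  assume u: "unique_expansion g h G"
  show "inj ?f"
  proof (rule injI)
    fix n m assume eq: "?f n = ?f m"
    define k where "k = max n m"
    have k: "n < N k" "m < N k"
      using less_N[of k] by (auto simp: k_def)
    let ?e = "\<lambda>n. tuple (expansions g h k ! n)"
    have "?e n \<in> coeffs g h" "?e m \<in> coeffs g h"
      using k nth_mem[of _ "expansions g h k"] unfolding coeffs_eq length_expansions_eq by blast+
    moreover have "eval_tuple (?e n) G = eval_tuple (?e m) G"
      using eq eval_digits_nth_expansions[OF assms k(1)] eval_digits_nth_expansions[OF assms k(2)]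
      by (simp add: eval_tuple_eq_eval_digits)
    ultimately have "?e n = ?e m"
      using u by (auto simp: unique_expansion_def inj_on_def)
    then have "expansions g h k ! n = expansions g h k ! m"
      using k by (intro tuple_inject) (simp_all add: length_nth_expansions)
    then show "n = m"
      using nth_eq_iff_index_eq[OF distinct_expansions[of k], of n m] k
      by (simp only: length_expansions_eq)
  qed
next
  assume inj: "inj ?f"
  show "unique_expansion g h G"
    unfolding unique_expansion_def
  proof (rule inj_onI)
    fix e d assume "e \<in> coeffs g h" "d \<in> coeffs g h" and eq: "eval_tuple e G = eval_tuple d G"
    then obtain k l where "e \<in> tuple ` set (expansions g h k)" "d \<in> tuple ` set (expansions g h l)"
      by (auto simp: coeffs_eq)
    then have "e \<in> tuple ` set (expansions g h (max k l))" "d \<in> tuple ` set (expansions g h (max k l))"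
      using tuple_expansions_mono[of _ "max k l"] max.cobounded1 max.cobounded2 by blast+
    then obtain n m where "e = tuple (expansions g h (max k l) ! n)" "n < N (max k l)"
      "d = tuple (expansions g h (max k l) ! m)" "m < N (max k l)"
      by (auto simp: in_set_conv_nth length_expansions_eq)
    moreover from this have "?f n = ?f m"
      using eq eval_digits_nth_expansions[OF assms, of n "max k l"]
        eval_digits_nth_expansions[OF assms, of m "max k l"]
      by (simp add: eval_tuple_eq_eval_digits)
    ultimately show "e = d"
      using inj by (auto dest: injD)
  qed
qed

lemma represented_iff:
  assumes "recurrent g h G"
  shows "n \<in> represented g h G \<longleftrightarrow>
    n \<ge> 1 \<and> int n \<in> range (phi (int (G 1)) (int (G 2) - int g * int (G 1)))"
proof -
  have "(\<exists>e\<in>coeffs g h. n = eval_tuple e G) \<longleftrightarrow>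
      (\<exists>k. \<exists>cs\<in>set (expansions g h k). n = eval_digits G cs)"
    by (auto simp: coeffs_eq eval_tuple_eq_eval_digits)
  also have "\<dots> \<longleftrightarrow> (\<exists>k. \<exists>m<N k. n = eval_digits G (expansions g h k ! m))"
    by (auto simp: set_conv_nth length_expansions_eq)
  also have "\<dots> \<longleftrightarrow> (\<exists>k. \<exists>m<N k. int n = phi (int (G 1)) (int (G 2) - int g * int (G 1)) m)"
    using eval_digits_nth_expansions[OF assms] by (metis of_nat_eq_iff)
  also have "\<dots> \<longleftrightarrow> int n \<in> range (phi (int (G 1)) (int (G 2) - int g * int (G 1)))"
    using less_N by blast
  finally show ?thesis
    by (simp add: represented_def)
qed

end

section \<open>Finitely many windows of the word\<close>

text \<open>
  The factors of length \<open>length P\<close> of \<open>xs @ P\<close> that start inside \<open>xs\<close>. In the infinite word a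
  high block is always followed by a fixed lower block \<open>P\<close>, so this list of windows
  depends only on \<open>xs\<close>, and it is additive under concatenation of blocks.
\<close>

fun windows :: "bool list \<Rightarrow> bool list \<Rightarrow> bool list list" where
  "windows P [] = []"
| "windows P (x # xs) = take (length P) (x # xs @ P) # windows P xs"

lemma windows_append:
  assumes "ys = [] \<or> (\<exists>zs. ys = P @ zs)"
  shows "windows P (xs @ ys) = windows P xs @ windows P ys"
proof (induction xs)
  case (Cons x xs)
  have "take (length P) ((x # xs) @ ys @ P) = take (length P) ((x # xs) @ P)"
    using assms by (elim disjE exE) (simp_all only: take_append append_assoc, auto)
  then show ?case
    using Cons by simp
qed auto

lemma windows_concat_replicate:
  assumes "xs = P @ zs"
  shows "windows P (concat (replicate n xs)) = concat (replicate n (windows P xs))"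
proof (induction n)
  case (Suc n)
  have "concat (replicate n xs) = [] \<or> (\<exists>zs. concat (replicate n xs) = P @ zs)"
    using assms by (cases n) auto
  then show ?case
    using Suc by (simp add: windows_append)
qed auto

lemma length_windows [simp]: "length (windows P xs) = length xs"
  by (induction xs) auto

lemma nth_windows: "i < length xs \<Longrightarrow> windows P xs ! i = take (length P) (drop i (xs @ P))"
proof (induction xs arbitrary: i)
  case (Cons x xs)
  then show ?case by (cases i) auto
qed auto

context numeration
begin

text \<open>
  Every block from the \<open>K\<close>-th on starts with the \<open>K\<close>-th one, so no window across a seam depends
  on which block comes next. Therefore the windows of blocks obey the same recursion as the blocks.
\<close>

lemma windows_block:
  assumes "K \<le> k"
  shows "windows (W K) (W (Suc (Suc k))) =
           concat (replicate g (windows (W K) (W (Suc k)))) @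
           concat (replicate h (windows (W K) (W k)))"
proof -
  obtain zs zs' where zs: "W k = W K @ zs" and zs': "W (Suc k) = W K @ zs'"
    using assms block_prefix[of K k] block_prefix[of K "Suc k"] by auto
  have "\<exists>us. concat (replicate h (W k)) = W K @ us"
    using h_pos zs by (cases h) auto
  then show ?thesis
    using windows_concat_replicate[OF zs] windows_concat_replicate[OF zs']
    by (simp add: windows_append)
qed

lemma nth_windows_block:
  assumes "K < k" "i < N k"
  shows "windows (W K) (W k) ! i = map w [i..<i + N K]"
proof -
  obtain j where j: "k = Suc j" "K \<le> j"
    using assms(1) by (cases k) auto
  obtain g' where g': "g = Suc g'"
    using g_pos by (cases g) auto
  obtain zs zs' where zs: "W j = W K @ zs" "W k = W K @ zs'"
    using j block_prefix[of K j] block_prefix[of K k] by auto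
  have "\<exists>us. concat (replicate g' (W k)) @ concat (replicate h (W j)) = W K @ us"
    using h_pos zs by (cases g'; cases h) auto
  then obtain us where us: "W (Suc k) = W k @ W K @ us"
    unfolding j by (auto simp: g')
  have "map w [i..<i + N K] = drop i (map w [0..<i + N K])"
    by (simp add: drop_map)
  also have "\<dots> = drop i (take (i + N K) (W (Suc k)))"
    using assms(2) us by (subst map_letter_take[of _ "Suc k"]) auto
  also have "\<dots> = take (N K) (drop i (W k @ W K))"
    using assms(2) unfolding us by (simp add: drop_take add.commute)
  also have "\<dots> = windows (W K) (W k) ! i"
    using assms(2) by (simp add: nth_windows)
  finally show ?thesis ..
qed

lemma windows_block_subset:
  assumes "K \<le> k"
  shows "set (windows (W K) (W k)) \<subseteq> set (windows (W K) (W K)) \<union> set (windows (W K) (W (Suc K)))"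
proof -
  have "set (windows (W K) (W (K + j)))
      \<subseteq> set (windows (W K) (W K)) \<union> set (windows (W K) (W (Suc K)))" for j
  proof (induction j rule: induct_nat_012)
    case (ge2 j)
    have "set (windows (W K) (W (Suc (Suc (K + j))))) =
        set (windows (W K) (W (Suc (K + j)))) \<union> set (windows (W K) (W (K + j)))"
      unfolding windows_block[OF le_add1] using g_pos h_pos by auto
    with ge2 show ?case by simp
  qed auto
  from this[of "k - K"] assms show ?thesis by simp
qed

text \<open>
  All factors of length \<open>N K\<close> are visible in two finite lists, which reduces statements about
  short factors of the infinite word to a computation.
\<close>

lemma factor_in_windows:
  "map w [n..<n + N K] \<in> set (windows (W K) (W K)) \<union> set (windows (W K) (W (Suc K)))"
proof -
  \<comment> \<open>Any block beyond the \<open>K\<close>-th that contains position \<open>n\<close> would do.\<close>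
  define k where "k = Suc (max n K)"
  have "n < N k" "K < k"
    using less_N[of k] by (auto simp: k_def)
  then have "map w [n..<n + N K] \<in> set (windows (W K) (W k))"
    by (metis nth_windows_block length_windows nth_mem)
  with windows_block_subset[of K k] \<open>K < k\<close> show ?thesis
    by auto
qed

end

section \<open>Asymptotics\<close>

context numeration
begin

abbreviation \<alpha> :: real where "\<alpha> \<equiv> alpha g h"
abbreviation \<beta> :: real where "\<beta> \<equiv> beta g h"

lemma alpha_plus_beta: "\<alpha> + \<beta> = real g"
  by (simp add: alpha_def beta_def field_simps)

lemma alpha_square: "\<alpha>\<^sup>2 = real g * \<alpha> + real h"
  and beta_square: "\<beta>\<^sup>2 = real g * \<beta> + real h"
proof -
  have "\<alpha> \<in> {x. x ^ 2 - real g * x - real h = 0}" "\<beta> \<in> {x. x ^ 2 - real g * x - real h = 0}"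
    unfolding alpha_beta_zeros by simp_all
  then show "\<alpha>\<^sup>2 = real g * \<alpha> + real h" "\<beta>\<^sup>2 = real g * \<beta> + real h"
    by simp_all
qed

lemma alpha_times_beta: "\<alpha> * \<beta> = - real h"
proof -
  have "\<alpha> * \<beta> = \<alpha> * (real g - \<alpha>)"
    by (simp flip: alpha_plus_beta)
  also have "\<dots> = real g * \<alpha> - \<alpha>\<^sup>2"
    by (simp add: algebra_simps power2_eq_square)
  finally show ?thesis
    by (simp add: alpha_square)
qed

lemma alpha_gt1: "\<alpha> > 1"
  using alpha_gt_1 g_pos h_pos by blast

lemma beta_neg: "\<beta> < 0"
proof (rule ccontr)
  assume "\<not> \<beta> < 0"
  then have "\<alpha> * \<beta> \<ge> 0"
    using alpha_gt1 by simp
  then show False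
    using alpha_times_beta h_pos by simp
qed

lemma abs_beta_less: "\<bar>\<beta>\<bar> < \<alpha>"
  using alpha_plus_beta beta_neg g_pos by auto

definition linear_recurrent :: "(nat \<Rightarrow> real) \<Rightarrow> bool" where
  "linear_recurrent x \<longleftrightarrow> (\<forall>k. x (Suc (Suc k)) = real g * x (Suc k) + real h * x k)"

lemma linear_recurrent_limit:
  assumes "linear_recurrent x"
  shows "(\<lambda>k. x k / \<alpha> ^ k) \<longlonglongrightarrow> (\<alpha> * x 1 + real h * x 0) / (\<alpha> * (\<alpha> - \<beta>))"
proof -
  \<comment> \<open>The coefficients of \<open>\<alpha> ^ k\<close> and \<open>\<beta> ^ k\<close> in the closed form of \<open>x k\<close>.\<close>
  define A where "A = (x 1 - \<beta> * x 0) / (\<alpha> - \<beta>)"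
  define B where "B = (\<alpha> * x 0 - x 1) / (\<alpha> - \<beta>)"
  have ne: "\<alpha> - \<beta> \<noteq> 0" "\<alpha> \<noteq> 0"
    using beta_neg alpha_gt1 by auto
  have AB: "(\<alpha> - \<beta>) * A = x 1 - \<beta> * x 0" "(\<alpha> - \<beta>) * B = \<alpha> * x 0 - x 1"
    using ne by (simp_all add: A_def B_def)
  have x: "x k = A * \<alpha> ^ k + B * \<beta> ^ k" for k
  proof (induction k rule: induct_nat_012)
    case 0
    have "(\<alpha> - \<beta>) * (A + B) = (\<alpha> - \<beta>) * x 0"
      unfolding distrib_left AB by (simp add: algebra_simps)
    then show ?case using ne by simp
  next
    case 1
    have "(\<alpha> - \<beta>) * (A * \<alpha> + B * \<beta>) = (\<alpha> - \<beta>) * A * \<alpha> + (\<alpha> - \<beta>) * B * \<beta>"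
      by (simp add: algebra_simps)
    also have "\<dots> = (\<alpha> - \<beta>) * x 1"
      unfolding AB by (simp add: algebra_simps)
    finally show ?case using ne by simp
  next
    case (ge2 k)
    have "x (Suc (Suc k)) = A * \<alpha> ^ k * (real g * \<alpha> + real h) + B * \<beta> ^ k * (real g * \<beta> + real h)"
      using assms ge2 unfolding linear_recurrent_def by (simp add: algebra_simps)
    also have "\<dots> = A * \<alpha> ^ Suc (Suc k) + B * \<beta> ^ Suc (Suc k)"
      unfolding alpha_square[symmetric] beta_square[symmetric] by (simp add: power2_eq_square)
    finally show ?case .
  qed
  have "\<bar>\<beta> / \<alpha>\<bar> < 1"
    using abs_beta_less alpha_gt1 by (simp add: abs_divide)
  then have "(\<lambda>k. A + B * (\<beta> / \<alpha>) ^ k) \<longlonglongrightarrow> A + B * 0"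
    by (intro tendsto_intros LIMSEQ_power_zero) simp
  moreover have "A + B * (\<beta> / \<alpha>) ^ k = x k / \<alpha> ^ k" for k
    using ne unfolding x by (simp add: field_simps)
  moreover have "A = (\<alpha> * x 1 + real h * x 0) / (\<alpha> * (\<alpha> - \<beta>))"
  proof -
    have "real h = - (\<alpha> * \<beta>)" using alpha_times_beta by simp
    then show ?thesis using ne by (simp add: A_def field_simps)
  qed
  ultimately show ?thesis by simp
qed

lemma linear_recurrent_ratio:
  assumes "linear_recurrent x" "linear_recurrent y" "\<alpha> * y 1 + real h * y 0 \<noteq> 0"
  shows "(\<lambda>k. x k / y k) \<longlonglongrightarrow> (\<alpha> * x 1 + real h * x 0) / (\<alpha> * y 1 + real h * y 0)"
proof -
  have ne: "\<alpha> - \<beta> \<noteq> 0" "\<alpha> \<noteq> 0"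
    using beta_neg alpha_gt1 by auto
  have "(\<lambda>k. (x k / \<alpha> ^ k) / (y k / \<alpha> ^ k)) \<longlonglongrightarrow>
     ((\<alpha> * x 1 + real h * x 0) / (\<alpha> * (\<alpha> - \<beta>))) / ((\<alpha> * y 1 + real h * y 0) / (\<alpha> * (\<alpha> - \<beta>)))"
    using assms(3) ne by (intro tendsto_divide linear_recurrent_limit assms) auto
  moreover have "(u / c) / (v / c) = u / v" if "c \<noteq> 0" for u v c :: real
    using that by simp
  ultimately show ?thesis
    using ne by simp
qed

text \<open>
  For \<open>\<beta>\<^sub>0 > 1\<close> the point is that \<open>\<beta>\<^sub>0 < \<alpha>\<close>, so the exponent of \<open>X\<close> is less than 1.
\<close>

lemma err_over_X_tendsto_0: "(\<lambda>X. err g h X / real X) \<longlonglongrightarrow> 0"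
proof -
  consider "beta0 g h < 1" | "beta0 g h = 1" | "beta0 g h > 1" by linarith
  then show ?thesis
  proof cases
    case 1
    then show ?thesis by (simp add: err_def lim_1_over_n)
  next
    case 2
    have "(\<lambda>X. ln (real X) / real X) \<longlonglongrightarrow> 0"
      by (rule filterlim_compose[OF ln_x_over_x_tendsto_0 filterlim_real_sequentially])
    with 2 show ?thesis by (simp add: err_def)
  next
    case 3
    define c where "c = log \<alpha> (beta0 g h)"
    have "c < 1"
      using abs_beta_less alpha_gt1 3 by (simp add: c_def beta0_def log_less_one_cancel_iff)
    then have "(\<lambda>X. real X powr (c - 1)) \<longlonglongrightarrow> 0"
      by (intro tendsto_neg_powr filterlim_real_sequentially) auto
    moreover have "eventually (\<lambda>X. real X powr (c - 1) = err g h X / real X) sequentially"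
      using eventually_gt_at_top[of 0]
      by eventually_elim (use 3 in \<open>auto simp: err_def powr_diff c_def\<close>)
    ultimately show ?thesis
      by (rule Lim_transform_eventually)
  qed
qed

lemma density_if_bigo_err:
  assumes "(\<lambda>X. f X - p * real X) \<in> O(err g h)"
  shows "(\<lambda>X. f X / real X) \<longlonglongrightarrow> p"
proof -
  obtain C where C: "eventually (\<lambda>X. norm (f X - p * real X) \<le> C * norm (err g h X)) sequentially"
    using assms by (auto elim: landau_o.bigE)
  have "(\<lambda>X. f X / real X - p) \<longlonglongrightarrow> 0"
  proof (rule tendsto_0_le[OF err_over_X_tendsto_0])
    show "eventually (\<lambda>X. norm (f X / real X - p) \<le> norm (err g h X / real X) * C) sequentially"
      using C eventually_gt_at_top[of 0]
    proof eventually_elim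
      case (elim X)
      have "f X / real X - p = (f X - p * real X) / real X"
        using elim by (simp add: diff_divide_distrib)
      then have "norm (f X / real X - p) = norm (f X - p * real X) / real X"
        by (simp add: abs_divide)
      also have "\<dots> \<le> C * norm (err g h X) / real X"
        using elim by (intro divide_right_mono) auto
      finally show ?case
        by (simp add: abs_divide mult.commute)
    qed
  qed
  then show ?thesis
    using LIM_zero_iff by blast
qed

lemma linear_recurrent_N: "linear_recurrent (\<lambda>k. real (N (j + k)))"
  by (simp add: linear_recurrent_def)

lemma linear_recurrent_G:
  "recurrent g h G \<Longrightarrow> linear_recurrent (\<lambda>k. real (G (Suc (j + k))))"
  by (simp add: linear_recurrent_def recurrentD)

definition slope :: "(nat \<Rightarrow> nat) \<Rightarrow> real" where
  "slope G = (\<alpha> * real (G 2) + real h * real (G 1)) / (\<alpha> * real (g + 1) + real h)"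

lemma slope_eq_rho: "slope G = 1 / rho g h G"
  by (simp add: slope_def rho_def algebra_simps)

lemma slope_pos: "G 1 > 0 \<Longrightarrow> slope G > 0"
  using alpha_gt1 h_pos unfolding slope_def
  by (intro divide_pos_pos add_nonneg_pos add_pos_nonneg) auto

lemma G_over_N_tendsto:
  assumes "recurrent g h G"
  shows "(\<lambda>k. real (G (Suc k)) / real (N k)) \<longlonglongrightarrow> slope G"
proof -
  have "\<alpha> * real (g + 1) + real h > 0"
    using alpha_gt1 h_pos by (intro add_pos_pos mult_pos_pos) auto
  then show ?thesis
    using linear_recurrent_ratio[OF linear_recurrent_G[OF assms, of 0] linear_recurrent_N[of 0]]
    by (simp add: slope_def eval_nat_numeral)
qed

lemma expansions_digit_le: "cs \<in> set (expansions g h k) \<Longrightarrow> d \<in> set cs \<Longrightarrow> d \<le> g + h"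
proof (induction k arbitrary: cs rule: induct_nat_012)
  case (ge2 k)
  from ge2.prems(1) consider c ds where "cs = ds @ [c]" "c < g" "ds \<in> set (expansions g h (Suc k))"
    | c ds where "cs = ds @ [c, g]" "c < h" "ds \<in> set (expansions g h k)"
    by auto
  then show ?case
    using ge2.IH ge2.prems(2) by cases fastforce+
qed auto

abbreviation \<phi> :: "(nat \<Rightarrow> nat) \<Rightarrow> nat \<Rightarrow> int" where
  "\<phi> G \<equiv> phi (int (G 1)) (int (G 2) - int g * int (G 1))"

lemma phi_nonneg: "recurrent g h G \<Longrightarrow> \<phi> G n \<ge> 0"
  using eval_digits_nth_expansions[of G n n] less_N[of n] by (metis of_nat_0_le_iff)

text \<open>
  If \<open>n\<close> has digits \<open>\<epsilon>\<^sub>i\<close> with respect to the block lengths \<open>N\<^sub>i\<close>, then \<open>\<phi>(n)\<close> has the same digits with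
  respect to \<open>G\<close>. Since \<open>G\<^bsub>i+1\<^esub> / N\<^sub>i\<close> tends to the slope, the high digits contribute an error that
  is small relative to \<open>n\<close>, and the few low digits contribute a bounded one.
\<close>

lemma phi_near_linear:
  assumes rec: "recurrent g h G" and "\<delta> > 0"
  shows "\<exists>C\<ge>0. \<forall>n. \<bar>of_int (\<phi> G n) - slope G * real n\<bar> \<le> \<delta> * real n + C"
proof -
  define d where "d i = real (G (Suc i)) - slope G * real (N i)" for i
  have "eventually (\<lambda>i. \<bar>real (G (Suc i)) / real (N i) - slope G\<bar> < \<delta>) sequentially"
    using tendstoD[OF G_over_N_tendsto[OF rec] \<open>\<delta> > 0\<close>] by (simp add: dist_real_def)
  then obtain k0 where k0: "\<And>i. i \<ge> k0 \<Longrightarrow> \<bar>real (G (Suc i)) / real (N i) - slope G\<bar> < \<delta>"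
    by (auto simp: eventually_sequentially)
  have d: "\<bar>d i\<bar> \<le> \<delta> * real (N i)" if "i \<ge> k0" for i
  proof -
    have "\<bar>d i\<bar> = \<bar>real (G (Suc i)) / real (N i) - slope G\<bar> * real (N i)"
      using N_pos[of i] by (simp add: d_def field_simps flip: abs_mult_pos')
    then show ?thesis
      using k0[OF that] by (simp add: mult_right_mono)
  qed
  define C where "C = (\<Sum>i<k0. real (g + h) * \<bar>d i\<bar>)"
  have "\<bar>of_int (\<phi> G n) - slope G * real n\<bar> \<le> \<delta> * real n + C" for n
  proof -
    define cs where "cs = expansions g h n ! n"
    have cs: "cs \<in> set (expansions g h n)"
      using less_N[of n] by (simp add: cs_def length_expansions_eq)
    have n: "n = eval_digits (\<lambda>i. N (i - 1)) cs"
      using arg_cong[OF eval_digits_N_expansions[of n], of "\<lambda>xs. xs ! n"] less_N[of n]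
      by (simp add: cs_def length_expansions_eq)
    have "real n = (\<Sum>i<length cs. real (cs ! i) * real (N i))"
      by (subst n) (simp add: eval_digits_def)
    then have n': "\<delta> * real n = (\<Sum>i<length cs. real (cs ! i) * (\<delta> * real (N i)))"
      by (simp add: sum_distrib_left mult_ac)
    have \<phi>: "\<phi> G n = int (eval_digits G cs)"
      using eval_digits_nth_expansions[OF rec less_N[of n]] by (simp add: cs_def)
    have "of_int (\<phi> G n) - slope G * real n = real (eval_digits G cs) - slope G * real (eval_digits (\<lambda>i. N (i - 1)) cs)"
      unfolding \<phi> by (subst n) simp
    also have "\<dots> = (\<Sum>i<length cs. real (cs ! i) * d i)"
      by (simp add: eval_digits_def d_def sum_distrib_left sum_subtractf algebra_simps)
    also have "\<bar>\<dots>\<bar> \<le> (\<Sum>i<length cs. \<bar>real (cs ! i) * d i\<bar>)"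
      by (rule sum_abs)
    also have "\<dots> \<le> (\<Sum>i<length cs. real (cs ! i) * (\<delta> * real (N i)) +
        (if i < k0 then real (g + h) * \<bar>d i\<bar> else 0))"
    proof (rule sum_mono)
      fix i assume i: "i \<in> {..<length cs}"
      have "real (cs ! i) \<le> real (g + h)"
        using expansions_digit_le[OF cs, of "cs ! i"] i by simp
      moreover have "0 \<le> real (cs ! i) * (\<delta> * real (N i))"
        using \<open>\<delta> > 0\<close> by simp
      ultimately show "\<bar>real (cs ! i) * d i\<bar> \<le> real (cs ! i) * (\<delta> * real (N i)) +
          (if i < k0 then real (g + h) * \<bar>d i\<bar> else 0)"
        using d[of i] mult_right_mono[of "real (cs ! i)" "real (g + h)" "\<bar>d i\<bar>"]
        by (auto simp: abs_mult mult_left_mono)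
    qed
    also have "\<dots> = \<delta> * real n + (\<Sum>i\<in>{..<length cs} \<inter> {..<k0}. real (g + h) * \<bar>d i\<bar>)"
      unfolding n' by (simp add: sum.distrib sum.inter_restrict del: of_nat_add)
    also have "\<dots> \<le> \<delta> * real n + C"
      unfolding C_def by (intro add_left_mono sum_mono2) auto
    finally show ?thesis .
  qed
  moreover have "C \<ge> 0" by (simp add: C_def sum_nonneg)
  ultimately show ?thesis by blast
qed

lemma represented_upto_eq:
  "recurrent g h G \<Longrightarrow> represented_upto g h G Y = {v \<in> {1..Y}. int v \<in> range (\<phi> G)}"
  by (auto simp: represented_upto_def represented_iff)

lemma nat_floor_ratio:
  fixes x :: real
  assumes "x > 0"
  shows "(\<lambda>n. real (nat \<lfloor>x * real n\<rfloor>) / real n) \<longlonglongrightarrow> x"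
proof (rule tendsto_sandwich)
  show "eventually (\<lambda>n. x - 1 / real n \<le> real (nat \<lfloor>x * real n\<rfloor>) / real n) sequentially"
    using eventually_gt_at_top[of 0]
  proof eventually_elim
    case (elim n)
    have "x * real n - 1 \<le> real (nat \<lfloor>x * real n\<rfloor>)" by linarith
    then have "(x * real n - 1) / real n \<le> real (nat \<lfloor>x * real n\<rfloor>) / real n"
      by (intro divide_right_mono) auto
    with elim show ?case by (simp add: diff_divide_distrib)
  qed
  show "eventually (\<lambda>n. real (nat \<lfloor>x * real n\<rfloor>) / real n \<le> x) sequentially"
    using eventually_gt_at_top[of 0]
  proof eventually_elim
    case (elim n)
    have "0 \<le> x * real n" using assms by simp
    then have "real (nat \<lfloor>x * real n\<rfloor>) \<le> x * real n" by linarith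
    with elim show ?case by (simp add: field_simps)
  qed
  show "(\<lambda>n. x - 1 / real n) \<longlonglongrightarrow> x"
    using tendsto_diff[OF tendsto_const lim_1_over_n, of x] by simp
qed auto

lemma density_along_multiples:
  fixes R :: "nat \<Rightarrow> nat" and x :: real
  assumes "(\<lambda>X. real (R X) / real X) \<longlonglongrightarrow> p" "x > 0"
  shows "(\<lambda>n. real (R (nat \<lfloor>x * real n\<rfloor>)) / real n) \<longlonglongrightarrow> p * x"
proof -
  let ?Y = "\<lambda>n. nat \<lfloor>x * real n\<rfloor>"
  have "filterlim (\<lambda>n. x * real n) at_top sequentially"
    using assms(2) by (intro filterlim_tendsto_pos_mult_at_top[OF tendsto_const] filterlim_real_sequentially)
  then have top: "filterlim ?Y at_top sequentially"
    by (intro filterlim_compose[OF filterlim_nat_sequentially] filterlim_compose[OF filterlim_floor_sequentially])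
  have "(\<lambda>n. (real (R (?Y n)) / real (?Y n)) * (real (?Y n) / real n)) \<longlonglongrightarrow> p * x"
    by (intro tendsto_mult filterlim_compose[OF assms(1) top] nat_floor_ratio assms(2))
  moreover have "eventually (\<lambda>n. (real (R (?Y n)) / real (?Y n)) * (real (?Y n) / real n)
      = real (R (?Y n)) / real n) sequentially"
    using eventually_compose_filterlim[OF eventually_gt_at_top[of 0] top]
  proof eventually_elim
    case (elim n)
    then have "real (?Y n) \<noteq> 0" by linarith
    moreover have "(a / b) * (b / c) = a / c" if "b \<noteq> 0" for a b c :: real
      using that by simp
    ultimately show ?case by blast
  qed
  ultimately show ?thesis
    by (rule Lim_transform_eventually)
qed

text \<open>
  Up to a small relative error, \<open>n\<close> steps of the path reach exactly the values up to \<open>slope G * n\<close>: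
  earlier values are not much larger and later ones not much smaller. So the number of distinct values
  among the first \<open>n\<close> lies between two counts of represented numbers whose densities are known.
\<close>

lemma distinct_values_density:
  assumes rec: "recurrent g h G" and "G 1 > 0"
    and p: "(\<lambda>X. real (card (represented_upto g h G X)) / real X) \<longlonglongrightarrow> p"
  shows "(\<lambda>n. real (card (\<phi> G ` {..<n})) / real n) \<longlonglongrightarrow> p * slope G"
proof (rule LIMSEQ_I)
  fix e :: real assume "e > 0"
  define c where "c = slope G"
  have c: "c > 0" using slope_pos[of G] \<open>G 1 > 0\<close> by (simp add: c_def)
  \<comment> \<open>Small enough that the two densities \<open>p (c \<plusminus> 2 \<delta>)\<close> stay within \<open>e / 4\<close> of \<open>p c\<close>, and that
    \<open>c - 2 \<delta>\<close> is positive.\<close>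
  define \<delta> where "\<delta> = min (c / 3) (e / (8 * (\<bar>p\<bar> + 1)))"
  have \<delta>: "\<delta> > 0" "c - 2 * \<delta> > 0" "c + 2 * \<delta> > 0"
    using c \<open>e > 0\<close> by (auto simp: \<delta>_def min_def field_simps)
  have "\<bar>p\<bar> * \<delta> \<le> \<bar>p\<bar> * (e / (8 * (\<bar>p\<bar> + 1)))"
    by (intro mult_left_mono) (auto simp: \<delta>_def)
  also have "\<dots> \<le> e / 8"
    using \<open>e > 0\<close> by (simp add: field_simps)
  finally have p\<delta>: "\<bar>p * \<delta>\<bar> \<le> e / 8"
    using \<delta>(1) by (simp add: abs_mult)
  obtain C where C: "C \<ge> 0" "\<And>n. \<bar>of_int (\<phi> G n) - c * real n\<bar> \<le> \<delta> * real n + C"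
    using phi_near_linear[OF rec \<delta>(1)] by (auto simp: c_def)
  let ?R = "\<lambda>X. card (represented_upto g h G X)"
  let ?lo = "\<lambda>n. nat \<lfloor>(c - 2 * \<delta>) * real n\<rfloor>"
  let ?hi = "\<lambda>n. nat \<lfloor>(c + 2 * \<delta>) * real n\<rfloor>"
  have finR: "finite (represented_upto g h G X)" for X
    by (simp add: represented_upto_eq[OF rec])
  have "eventually (\<lambda>n. \<bar>real (?R (?lo n)) / real n - p * (c - 2 * \<delta>)\<bar> < e / 4) sequentially"
    using tendstoD[OF density_along_multiples[OF p \<delta>(2)], of "e / 4"] \<open>e > 0\<close>
    by (simp add: dist_real_def)
  moreover have "eventually (\<lambda>n. \<bar>real (?R (?hi n)) / real n - p * (c + 2 * \<delta>)\<bar> < e / 4) sequentially"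
    using tendstoD[OF density_along_multiples[OF p \<delta>(3)], of "e / 4"] \<open>e > 0\<close>
    by (simp add: dist_real_def)
  moreover have "eventually (\<lambda>n. real n > max (C / \<delta>) (4 / e)) sequentially"
    using filterlim_at_top_dense[THEN iffD1, OF filterlim_real_sequentially] by blast
  ultimately have "eventually (\<lambda>n. norm (real (card (\<phi> G ` {..<n})) / real n - p * c) < e) sequentially"
  proof eventually_elim
    case (elim n)
    have n: "C < \<delta> * real n" "1 < e / 4 * real n"
      using elim(3) \<delta>(1) \<open>e > 0\<close> by (auto simp: field_simps)
    then have npos: "real n > 0"
      using C(1) \<delta>(1) by (metis mult_zero_right not_le of_nat_0_le_iff order_le_less)
    have hi: "\<phi> G m \<le> int (?hi n)" if "m < n" for m
    proof -
      have "of_int (\<phi> G m) \<le> (c + \<delta>) * real m + C"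
        using C(2)[of m] by (simp add: algebra_simps abs_le_iff)
      also have "(c + \<delta>) * real m \<le> (c + \<delta>) * real n"
        using that c \<delta>(1) by (intro mult_left_mono) auto
      finally have "of_int (\<phi> G m) \<le> (c + 2 * \<delta>) * real n"
        using n(1) by (simp add: algebra_simps)
      then show ?thesis by linarith
    qed
    have lo: "int (?lo n) < \<phi> G m" if "m \<ge> n" for m
    proof -
      have "(c - \<delta>) * real m - C \<le> of_int (\<phi> G m)"
        using C(2)[of m] by (simp add: algebra_simps abs_le_iff)
      moreover have "(c - \<delta>) * real n \<le> (c - \<delta>) * real m"
        using that \<delta> by (intro mult_left_mono) auto
      ultimately have "(c - 2 * \<delta>) * real n < of_int (\<phi> G m)"
        using n(1) by (simp add: algebra_simps)
      moreover have "(c - 2 * \<delta>) * real n \<ge> 0"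
        using \<delta>(2) by simp
      ultimately show ?thesis by linarith
    qed
    have "\<phi> G ` {..<n} \<subseteq> int ` insert 0 (represented_upto g h G (?hi n))"
    proof
      fix v assume "v \<in> \<phi> G ` {..<n}"
      then obtain m where m: "v = \<phi> G m" "m < n" by auto
      have "v = int (nat v)"
        using phi_nonneg[OF rec, of m] m by simp
      moreover have "nat v \<le> ?hi n"
        using hi[of m] m unfolding nat_le_iff by simp
      ultimately have "nat v \<in> insert 0 (represented_upto g h G (?hi n))"
        using m by (auto simp: represented_upto_eq[OF rec] simp del: nat_le_iff)
      then show "v \<in> int ` insert 0 (represented_upto g h G (?hi n))"
        using \<open>v = int (nat v)\<close> by blast
    qed
    then have "card (\<phi> G ` {..<n}) \<le> card (int ` insert 0 (represented_upto g h G (?hi n)))"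
      by (intro card_mono) (auto simp: finR)
    also have "\<dots> \<le> Suc (?R (?hi n))"
      using finR by (simp add: card_image card_insert_if)
    finally have 1: "real (card (\<phi> G ` {..<n})) / real n \<le> real (?R (?hi n)) / real n + 1 / real n"
      using npos by (simp add: field_simps)
    have "int ` represented_upto g h G (?lo n) \<subseteq> \<phi> G ` {..<n}"
    proof
      fix v assume "v \<in> int ` represented_upto g h G (?lo n)"
      then obtain u where u: "v = int u" "u \<in> represented_upto g h G (?lo n)" by blast
      then have "u \<le> ?lo n" "int u \<in> range (\<phi> G)"
        unfolding represented_upto_eq[OF rec] by simp_all
      then obtain m where m: "v = \<phi> G m" "v \<le> int (?lo n)"
        using u(1) by (metis of_nat_mono rangeE)
      then have "m < n" using lo[of m] by linarith
      with m show "v \<in> \<phi> G ` {..<n}" by auto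
    qed
    then have "card (int ` represented_upto g h G (?lo n)) \<le> card (\<phi> G ` {..<n})"
      by (intro card_mono) auto
    then have 2: "real (?R (?lo n)) / real n \<le> real (card (\<phi> G ` {..<n})) / real n"
      using npos by (simp add: card_image divide_right_mono)
    have "1 / real n < e / 4"
      using n(2) npos by (simp add: field_simps)
    then show ?case
      using 1 2 elim(1,2) p\<delta> unfolding real_norm_def abs_less_iff abs_le_iff
      by (simp add: algebra_simps)
  qed
  then show "\<exists>no. \<forall>n\<ge>no. norm (real (card (\<phi> G ` {..<n})) / real n - p * slope G) < e"
    by (simp add: eventually_sequentially c_def)
qed

lemma density_if_unique:
  assumes "recurrent g h G" and "G 1 > 0" and "inj (\<phi> G)"
    and "(\<lambda>X. real (card (represented_upto g h G X)) / real X) \<longlonglongrightarrow> p"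
  shows "p = rho g h G"
proof -
  have "card (\<phi> G ` {..<n}) = n" for n
    using assms(3) by (subst card_image) (auto intro: inj_on_subset)
  then have "(\<lambda>n. real n / real n) \<longlonglongrightarrow> p * slope G"
    using distinct_values_density[OF assms(1,2,4)] by simp
  moreover have "(\<lambda>n. real n / real n) \<longlonglongrightarrow> 1"
    by (rule Lim_transform_eventually[OF tendsto_const])
       (use eventually_gt_at_top[of 0] in eventually_elim, simp)
  ultimately have "p * slope G = 1"
    using LIMSEQ_unique by blast
  then show ?thesis
    using slope_pos[of G, OF assms(2)] by (auto simp: slope_eq_rho field_simps)
qed

end

section \<open>Collisions come from light factors\<close>

text \<open>
  No nonempty prefix of the list, added to the starting value \<open>s\<close>, sums to zero. The accumulator
  keeps the evaluation on concrete windows linear in their length.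
\<close>

fun zero_free :: "int \<Rightarrow> int \<Rightarrow> int \<Rightarrow> bool list \<Rightarrow> bool" where
  "zero_free a b s [] = True"
| "zero_free a b s (x # u) = (let t = s + letter_weight a b x in if t = 0 then False else zero_free a b t u)"

lemma zero_free_iff:
  "zero_free a b s u \<longleftrightarrow> (\<forall>m\<in>{1..length u}. s + weight a b (take m u) \<noteq> 0)"
proof (induction u arbitrary: s)
  case (Cons x u)
  have "(\<forall>m\<in>{1..length (x # u)}. P m) \<longleftrightarrow> P 1 \<and> (\<forall>m\<in>{1..length u}. P (Suc m))" for P
  proof -
    have "{1..length (x # u)} = insert 1 (Suc ` {1..length u})"
      by (auto simp: image_Suc_atLeastAtMost)
    then show ?thesis by (simp only: ball_simps)
  qed
  then show ?case
    using Cons by (simp add: Let_def add.assoc)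
qed simp

text \<open>
  Call a factor light if its weight for \<open>a = 1\<close>, \<open>b = -c\<close> is negative; for \<open>c = g\<close> this is the
  condition \<open>i < g j\<close> on its letter counts. The equation compares \<open>j / (c j - i)\<close> with \<open>x / y\<close>: this
  is the value of \<open>G\<^sub>1 / G\<^sub>2\<close> for which a factor with these letter counts has weight zero.
\<close>

definition light_prefixes_in :: "int \<Rightarrow> nat \<Rightarrow> (nat \<times> nat) list \<Rightarrow> bool list \<Rightarrow> bool" where
  "light_prefixes_in c M I u \<longleftrightarrow> (\<forall>m\<in>set [1..<Suc (length u)]. let v = take m u in
     weight 1 (- c) v < 0 \<longrightarrow> m < M \<and>
       (\<exists>(x, y)\<in>set I. int y * weight 0 1 v = int x * - weight 1 (- c) v))"

text \<open>
  For \<open>a = G\<^sub>1\<close>, \<open>b = G\<^sub>2 - g G\<^sub>1\<close> this reads \<open>i a + j b = G\<^sub>1 (i - g j) + G\<^sub>2 j\<close>, so a factor of weight zero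
  is light.
\<close>

lemma weight_split: "weight a (b - c * a) u = a * weight 1 (- c) u + b * weight 0 1 u"
  by (induction u) (auto simp: letter_weight_def algebra_simps)

lemma weight_b_nonneg: "weight 0 1 u \<ge> 0"
  by (induction u) (auto simp: letter_weight_def)

lemma weight_no_b: "weight 0 1 u = 0 \<Longrightarrow> weight 1 c u = int (length u)"
proof (induction u)
  case (Cons x u)
  then show ?case
    using weight_b_nonneg[of u] by (auto simp: letter_weight_def split: if_splits)
qed auto

lemma length_filter_concat_replicate:
  "length (filter Q (concat (replicate n xs))) = n * length (filter Q xs)"
  by (induction n) auto

text \<open>
  The number of positions in the \<open>k\<close>-th block from which the path does not return to the same value
  within the window length. If collisions are no longer than a window, these are the positions
  where a value is taken for the last time.
\<close>

definition last_visits :: "nat \<Rightarrow> nat \<Rightarrow> int \<Rightarrow> int \<Rightarrow> nat \<Rightarrow> nat \<Rightarrow> nat" where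
  "last_visits g h a b K k =
     length (filter (zero_free a b 0) (windows (block g h K) (block g h k)))"

text \<open>
  The bound \<open>2 * M - 1\<close> on the window length is what the induction over longer factors needs.
\<close>

definition light_factors_ok :: "nat \<Rightarrow> nat \<Rightarrow> nat \<Rightarrow> nat \<Rightarrow> (nat \<times> nat) list \<Rightarrow> bool" where
  "light_factors_ok g h K M I \<longleftrightarrow> 0 < M \<and> 2 * M \<le> Suc (length (block g h K)) \<and>
     (\<forall>u\<in>set (windows (block g h K) (block g h K)) \<union>
          set (windows (block g h K) (block g h (Suc K))). light_prefixes_in (int g) M I u)"

context numeration
begin

lemma light_factor:
  assumes ok: "light_factors_ok g h K M I"
    and "1 \<le> m" "m \<le> N K" "weight 1 (- int g) (map w [n..<n + m]) < 0"
  shows "m < M \<and> (\<exists>(x, y)\<in>set I. int y * weight 0 1 (map w [n..<n + m]) =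
           int x * - weight 1 (- int g) (map w [n..<n + m]))"
proof -
  have "light_prefixes_in (int g) M I (map w [n..<n + N K])"
    using ok factor_in_windows[of n K] by (auto simp: light_factors_ok_def)
  moreover have "m \<in> set [1..<Suc (length (map w [n..<n + N K]))]"
    using assms(2,3) by (simp del: upt_Suc)
  moreover have "take m (map w [n..<n + N K]) = map w [n..<n + m]"
    using assms(3) by (simp add: take_map)
  ultimately show ?thesis
    using assms(4) unfolding light_prefixes_in_def Let_def by metis
qed

text \<open>
  The windows settle lengths up to \<open>N K \<ge> 2 * M - 1\<close>. A longer factor splits into two parts of length at
  least \<open>M\<close>, and weights add up.
\<close>

lemma long_factors_not_light:
  assumes ok: "light_factors_ok g h K M I" and "M \<le> m"
  shows "weight 1 (- int g) (map w [n..<n + m]) \<ge> 0"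
  using \<open>M \<le> m\<close>
proof (induction m arbitrary: n rule: less_induct)
  case (less m)
  have M: "0 < M" "2 * M \<le> Suc (N K)"
    using ok by (auto simp: light_factors_ok_def)
  show ?case
  proof (cases "m \<le> N K")
    case True
    then show ?thesis
      using light_factor[OF ok, of m n] less.prems M by linarith
  next
    case False
    then have "M \<le> m - M" "m - M < m" "M < m"
      using M by auto
    moreover from this have "[n..<n + m] = [n..<n + M] @ [n + M..<n + M + (m - M)]"
      by (metis add.assoc le_add1 le_add_diff_inverse less_imp_le_nat upt_add_eq_append)
    ultimately show ?thesis
      using less.IH[of "m - M" "n + M"] less.IH[of M n] by simp
  qed
qed

text \<open>
  The identity \<open>G\<^sub>1 (g j - i) = G\<^sub>2 j\<close> for a factor of weight zero fixes the ratio \<open>G\<^sub>1 / G\<^sub>2\<close>, and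
  coprimality then fixes the pair.
\<close>

lemma collision:
  assumes ok: "light_factors_ok g h K M I"
    and I: "\<And>x y. (x, y) \<in> set I \<Longrightarrow> coprime x y"
    and G: "G 1 > 0" "G 2 > 0" "coprime (G 1) (G 2)"
    and "n < n'" "\<phi> G n = \<phi> G n'"
  shows "n' - n < M \<and> (G 1, G 2) \<in> set I"
proof -
  define m where "m = n' - n"
  define v where "v = map w [n..<n + m]"
  have m: "1 \<le> m" "n' = n + m"
    using \<open>n < n'\<close> by (auto simp: m_def)
  have zero: "int (G 1) * weight 1 (- int g) v + int (G 2) * weight 0 1 v = 0"
  proof -
    have "weight (int (G 1)) (int (G 2) - int g * int (G 1)) v = \<phi> G (n + m) - \<phi> G n"
      unfolding v_def by (rule phi_diff[symmetric]) simp
    also have "\<dots> = 0"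
      using assms(7) m(2) by simp
    finally show ?thesis
      by (simp add: weight_split)
  qed
  have "weight 0 1 v \<noteq> 0"
  proof
    assume "weight 0 1 v = 0"
    with zero weight_no_b[OF this, of "- int g"] G(1) m(1) show False
      by (simp add: v_def)
  qed
  then have "int (G 2) * weight 0 1 v > 0"
    using weight_b_nonneg[of v] G(2) by simp
  then have "int (G 1) * weight 1 (- int g) v < 0"
    using zero by linarith
  then have light: "weight 1 (- int g) v < 0"
    using G(1) by (simp add: mult_less_0_iff)
  then have "m < M"
    using long_factors_not_light[OF ok, of m n] by (force simp: v_def)
  moreover have "M \<le> N K"
    using ok by (auto simp: light_factors_ok_def)
  ultimately obtain x y where xy: "(x, y) \<in> set I"
    "int y * weight 0 1 v = int x * - weight 1 (- int g) v"
    using light_factor[OF ok m(1), of n] light by (auto simp: v_def)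
  have "int (y * G 1) * weight 1 (- int g) v = int (x * G 2) * weight 1 (- int g) v"
  proof -
    have "int (y * G 1) * weight 1 (- int g) v = int y * (int (G 1) * weight 1 (- int g) v)"
      by simp
    also have "int (G 1) * weight 1 (- int g) v = - (int (G 2) * weight 0 1 v)"
      using zero by linarith
    also have "int y * - (int (G 2) * weight 0 1 v) = - int (G 2) * (int y * weight 0 1 v)"
      by simp
    finally show ?thesis
      unfolding xy(2) by (simp add: mult.commute)
  qed
  then have "int (y * G 1) = int (x * G 2)"
    using light by simp
  then have "y * G 1 = x * G 2"
    by (simp only: of_nat_eq_iff)
  then have "G 1 = x \<and> G 2 = y"
    using coprime_crossproduct_nat[of "G 1" "G 2" x y] G(3) I[OF xy(1)]
    by (simp add: mult.commute)
  with \<open>m < M\<close> xy(1) show ?thesis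
    by (auto simp: m_def)
qed

lemma last_visits_rec:
  assumes "K \<le> k"
  shows "last_visits g h a b K (Suc (Suc k)) =
    g * last_visits g h a b K (Suc k) + h * last_visits g h a b K k"
  by (simp only: last_visits_def windows_block[OF assms] filter_append length_append
      length_filter_concat_replicate)

text \<open>
  Consider the positions up to one window beyond \<open>N k\<close>. If the last of them with a given value comes
  before \<open>N k\<close>, no later position can have this value, since collisions fit into a window; otherwise
  it is one of the \<open>N K\<close> extra positions. So last visits count distinct values up to \<open>N K\<close>.
\<close>

lemma card_image_last_visits:
  assumes short: "\<And>n n'. n < n' \<Longrightarrow> phi a b n = phi a b n' \<Longrightarrow> n' - n \<le> N K" and "K < k"
  shows "last_visits g h a b K k \<le> card (phi a b ` {..<N k + N K})"
    and "card (phi a b ` {..<N k + N K}) \<le> last_visits g h a b K k + N K"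
proof -
  define S where "S = {i. i < N k \<and> (\<forall>j>i. phi a b j \<noteq> phi a b i)}"
  have last: "zero_free a b 0 (map w [i..<i + N K]) \<longleftrightarrow> (\<forall>j>i. phi a b j \<noteq> phi a b i)" for i
  proof -
    have "zero_free a b 0 (map w [i..<i + N K]) \<longleftrightarrow>
        (\<forall>m\<in>{1..N K}. weight a b (map w [i..<i + m]) \<noteq> 0)"
      by (auto simp: zero_free_iff take_map)
    also have "\<dots> \<longleftrightarrow> (\<forall>m\<in>{1..N K}. phi a b (i + m) \<noteq> phi a b i)"
      by (simp flip: phi_diff)
    also have "\<dots> \<longleftrightarrow> (\<forall>j>i. phi a b j \<noteq> phi a b i)"
    proof (intro iffI allI impI ballI notI)
      fix j assume *: "\<forall>m\<in>{1..N K}. phi a b (i + m) \<noteq> phi a b i" "i < j" "phi a b j = phi a b i"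
      then have "j - i \<in> {1..N K}"
        using short[of i j] by auto
      with * show False by force
    qed auto
    finally show ?thesis .
  qed
  have "last_visits g h a b K k = card {i. i < N k \<and> zero_free a b 0 (map w [i..<i + N K])}"
    unfolding last_visits_def length_filter_conv_card
    by (intro arg_cong[of _ _ card]) (auto simp: nth_windows_block[OF \<open>K < k\<close>])
  then have S: "last_visits g h a b K k = card S"
    by (simp add: S_def last)
  have "inj_on (phi a b) S"
    unfolding S_def inj_on_def by (metis (mono_tags, lifting) linorder_neqE_nat mem_Collect_eq)
  then have "card S = card (phi a b ` S)"
    by (simp add: card_image)
  also have "\<dots> \<le> card (phi a b ` {..<N k + N K})"
    by (intro card_mono image_mono) (auto simp: S_def)
  finally show "last_visits g h a b K k \<le> card (phi a b ` {..<N k + N K})"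
    by (simp add: S)
  have "phi a b ` {..<N k + N K} \<subseteq> phi a b ` S \<union> phi a b ` {N k..<N k + N K}"
  proof
    fix v assume "v \<in> phi a b ` {..<N k + N K}"
    then obtain i where i: "v = phi a b i" "i < N k + N K" by auto
    \<comment> \<open>The last visit to \<open>v\<close> in the extended range; it is final if it lies before \<open>N k\<close>.\<close>
    define j where "j = Max {j. j < N k + N K \<and> phi a b j = v}"
    have fin: "finite {j. j < N k + N K \<and> phi a b j = v}" by simp
    have j: "j < N k + N K" "phi a b j = v"
      using Max_in[OF fin] i unfolding j_def by blast+
    show "v \<in> phi a b ` S \<union> phi a b ` {N k..<N k + N K}"
    proof (cases "j < N k")
      case True
      have "phi a b j' \<noteq> phi a b j" if "j < j'" for j'
      proof
        assume eq: "phi a b j' = phi a b j"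
        then have "j' < N k + N K"
          using short[of j j'] True that by auto
        then have "j' \<le> j"
          using Max_ge[OF fin, of j'] eq j by (simp add: j_def)
        with that show False by simp
      qed
      with True j(2) show ?thesis by (auto simp: S_def)
    qed (use j in auto)
  qed
  then have "card (phi a b ` {..<N k + N K}) \<le> card (phi a b ` S \<union> phi a b ` {N k..<N k + N K})"
    by (intro card_mono) (auto simp: S_def)
  also have "\<dots> \<le> card (phi a b ` S) + card (phi a b ` {N k..<N k + N K})"
    by (rule card_Un_le)
  also have "card (phi a b ` {N k..<N k + N K}) \<le> N K"
    using card_image_le[of "{N k..<N k + N K}" "phi a b"] by simp
  finally show "card (phi a b ` {..<N k + N K}) \<le> last_visits g h a b K k + N K"
    using \<open>card S = card (phi a b ` S)\<close> by (simp add: S)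
qed

lemma filterlim_N: "filterlim N at_top sequentially"
  by (rule filterlim_at_top_mono[OF filterlim_ident]) (simp add: less_N less_imp_le)

text \<open>
  Last visits in block \<open>k\<close> and the weight \<open>G (Suc k)\<close> of that block satisfy the same linear
  recurrence, and the density is the limit of their ratio.
\<close>

lemma density_if_short_collisions:
  assumes rec: "recurrent g h G" and Gpos: "\<And>k. G (Suc k) > 0"
    and p: "(\<lambda>X. real (card (represented_upto g h G X)) / real X) \<longlonglongrightarrow> p"
    and short: "\<And>n n'. n < n' \<Longrightarrow> \<phi> G n = \<phi> G n' \<Longrightarrow> n' - n \<le> N K"
  defines "F \<equiv> last_visits g h (int (G 1)) (int (G 2) - int g * int (G 1)) K"
  shows "p = (\<alpha> * real (F (Suc K)) + real h * real (F K)) /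
             (\<alpha> * real (G (Suc (Suc K))) + real h * real (G (Suc K)))"
proof -
  define L where "L = real (N K)"
  define D where "D n = real (card (\<phi> G ` {..<n}))" for n
  have G1: "G 1 > 0"
    using Gpos[of 0] by simp
  have N0: "real (N k) > 0" for k
    using N_pos[of k] by simp
  have Ntop: "filterlim (\<lambda>k. real (N k)) at_top sequentially"
    by (rule filterlim_compose[OF filterlim_real_sequentially filterlim_N])
  have L0: "(\<lambda>k. L / real (N k)) \<longlonglongrightarrow> 0"
    by (rule tendsto_divide_0[OF tendsto_const filterlim_at_top_imp_at_infinity[OF Ntop]])
  have "filterlim (\<lambda>k. N k + N K) at_top sequentially"
    by (rule filterlim_at_top_mono[OF filterlim_N]) simp
  then have "(\<lambda>k. D (N k + N K) / real (N k + N K)) \<longlonglongrightarrow> p * slope G"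
    using filterlim_compose[OF distinct_values_density[OF rec G1 p]]
    unfolding D_def by blast
  then have "(\<lambda>k. D (N k + N K) / real (N k + N K) * (1 + L / real (N k))) \<longlonglongrightarrow> p * slope G * (1 + 0)"
    by (intro tendsto_intros L0)
  moreover have "D (N k + N K) / real (N k + N K) * (1 + L / real (N k)) = D (N k + N K) / real (N k)" for k
  proof -
    have "1 + L / real (N k) = real (N k + N K) / real (N k)"
      using N0[of k] by (simp add: L_def add_divide_distrib)
    moreover have "u / c * (c / d) = u / d" if "c \<noteq> 0" for u c d :: real
      using that by simp
    moreover have "real (N k + N K) \<noteq> 0"
      using N0[of k] by linarith
    ultimately show ?thesis by metis
  qed
  ultimately have D: "(\<lambda>k. D (N k + N K) / real (N k)) \<longlonglongrightarrow> p * slope G"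
    by simp
  have F: "F k \<le> card (\<phi> G ` {..<N k + N K})" "card (\<phi> G ` {..<N k + N K}) \<le> F k + N K"
    if "K < k" for k
    unfolding F_def by (rule card_image_last_visits; use short that in blast)+
  have "(\<lambda>k. real (F k) / real (N k)) \<longlonglongrightarrow> p * slope G"
  proof (rule tendsto_sandwich[OF _ _ _ D])
    show "(\<lambda>k. D (N k + N K) / real (N k) - L / real (N k)) \<longlonglongrightarrow> p * slope G"
      using tendsto_diff[OF D L0] by simp
    show "eventually (\<lambda>k. D (N k + N K) / real (N k) - L / real (N k) \<le> real (F k) / real (N k)) sequentially"
      using eventually_gt_at_top[of K]
    proof eventually_elim
      case (elim k)
      have "D (N k + N K) - L \<le> real (F k)"
        using F(2)[OF elim] unfolding D_def L_def by linarith
      then show ?case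
        by (simp add: divide_right_mono flip: diff_divide_distrib)
    qed
    show "eventually (\<lambda>k. real (F k) / real (N k) \<le> D (N k + N K) / real (N k)) sequentially"
      using eventually_gt_at_top[of K]
    proof eventually_elim
      case (elim k)
      have "real (F k) \<le> D (N k + N K)"
        using F(1)[OF elim] unfolding D_def by linarith
      then show ?case
        by (simp add: divide_right_mono)
    qed
  qed
  then have "(\<lambda>k. (real (F k) / real (N k)) / (real (G (Suc k)) / real (N k))) \<longlonglongrightarrow> p * slope G / slope G"
    using slope_pos[of G, OF G1] by (intro tendsto_divide G_over_N_tendsto[OF rec]) auto
  moreover have "(real (F k) / real (N k)) / (real (G (Suc k)) / real (N k)) = real (F k) / real (G (Suc k))" for k
  proof -
    have "(u / c) / (v / c) = u / v" if "c \<noteq> 0" for u v c :: real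
      using that by simp
    moreover have "real (N k) \<noteq> 0"
      using N0[of k] by linarith
    ultimately show ?thesis by blast
  qed
  moreover have "p * slope G / slope G = p"
    using slope_pos[of G, OF G1] by simp
  ultimately have "(\<lambda>k. real (F k) / real (G (Suc k))) \<longlonglongrightarrow> p"
    by (simp only:)
  then have "(\<lambda>k. real (F (K + k)) / real (G (Suc (K + k)))) \<longlonglongrightarrow> p"
    using LIMSEQ_ignore_initial_segment[of "\<lambda>k. real (F k) / real (G (Suc k))" p K] by (simp add: add.commute)
  moreover have "(\<lambda>k. real (F (K + k)) / real (G (Suc (K + k)))) \<longlonglongrightarrow>
      (\<alpha> * real (F (K + 1)) + real h * real (F (K + 0))) /
      (\<alpha> * real (G (Suc (K + 1))) + real h * real (G (Suc (K + 0))))"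
  proof (rule linear_recurrent_ratio)
    show "linear_recurrent (\<lambda>k. real (F (K + k)))"
      by (simp add: linear_recurrent_def F_def last_visits_rec)
    show "linear_recurrent (\<lambda>k. real (G (Suc (K + k))))"
      by (rule linear_recurrent_G[OF rec])
    have "0 < \<alpha> * real (G (Suc (K + 1)))" "0 \<le> real h * real (G (Suc (K + 0)))"
      using alpha_gt1 Gpos[of "K + 1"] by auto
    then show "\<alpha> * real (G (Suc (K + 1))) + real h * real (G (Suc (K + 0))) \<noteq> 0"
      by linarith
  qed
  ultimately have "p = (\<alpha> * real (F (K + 1)) + real h * real (F (K + 0))) /
      (\<alpha> * real (G (Suc (K + 1))) + real h * real (G (Suc (K + 0))))"
    by (rule LIMSEQ_unique)
  then show ?thesis by simp
qed

lemma not_inj_phi: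
  assumes "\<not> distinct (prefix_weights a b (W k))"
  shows "\<not> inj (phi a b)"
  using assms by (auto simp: prefix_weights_block distinct_map intro: inj_on_subset)

text \<open>
  The pair \<open>(1, 1)\<close> always occurs among the ratios of light factors, since the letter \<open>b\<close> can be preceded
  by \<open>g - 1\<close> letters \<open>a\<close>; it is excluded by \<open>G\<^sub>1 \<noteq> G\<^sub>2\<close>.
\<close>

lemma exceptional_classification:
  assumes G: "G \<in> rec_seqs g h"
    and p: "(\<lambda>X. real (card (represented_upto g h G X)) / real X) \<longlonglongrightarrow> p"
    and ok: "light_factors_ok g h K M ((1, 1) # I)"
    and coprime: "\<forall>(x, y)\<in>set I. coprime x y"
    and collide: "\<forall>(x, y)\<in>set I. \<not> distinct (prefix_weights (int x) (int y - int g * int x) (W k))"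
  shows "unique_expansion g h G \<longleftrightarrow> (G 1, G 2) \<notin> set I"
    and "(G 1, G 2) \<notin> set I \<Longrightarrow> p = rho g h G"
    and "F = last_visits g h (int (G 1)) (int (G 2) - int g * int (G 1)) K \<Longrightarrow>
         p = (\<alpha> * real (F (Suc K)) + real h * real (F K)) /
             (\<alpha> * real (G (Suc (Suc K))) + real h * real (G (Suc K)))"
proof -
  have rec: "recurrent g h G" and pos: "\<And>k. G (Suc k) > 0"
    and cop: "coprime (G 1) (G 2)" and neq: "G 1 \<noteq> G 2"
    using G by (auto simp: rec_seqs_def recurrent_def)
  have pos12: "G 1 > 0" "G 2 > 0"
    using pos[of 0] pos[of 1] by (simp_all add: eval_nat_numeral)
  have coprime': "coprime x y" if "(x, y) \<in> set ((1, 1) # I)" for x y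
    using coprime that by auto
  have coll: "n' - n < M" "(G 1, G 2) \<in> set I" if "n < n'" "\<phi> G n = \<phi> G n'" for n n'
    using collision[OF ok coprime' pos12 cop that] neq by auto
  show iff: "unique_expansion g h G \<longleftrightarrow> (G 1, G 2) \<notin> set I"
    unfolding unique_expansion_iff[OF rec]
  proof
    show "(G 1, G 2) \<notin> set I" if "inj (\<phi> G)"
      using that collide not_inj_phi by blast
    show "inj (\<phi> G)" if "(G 1, G 2) \<notin> set I"
      using that coll(2) by (metis injI linorder_neqE_nat)
  qed
  show "p = rho g h G" if "(G 1, G 2) \<notin> set I"
    using density_if_unique[OF rec pos12(1) _ p] that iff unique_expansion_iff[OF rec] by blast
  have "M \<le> N K"
    using ok by (simp add: light_factors_ok_def)
  then have short: "n' - n \<le> N K" if "n < n'" "\<phi> G n = \<phi> G n'" for n n'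
    using coll(1)[OF that] by simp
  show "p = (\<alpha> * real (F (Suc K)) + real h * real (F K)) /
      (\<alpha> * real (G (Suc (Suc K))) + real h * real (G (Suc K)))"
    if "F = last_visits g h (int (G 1)) (int (G 2) - int g * int (G 1)) K"
    unfolding that by (rule density_if_short_collisions[OF rec pos p short])
qed

end

section \<open>The three cases\<close>

text \<open>
  The window length is that of \<open>block g h 4\<close>, which is 41, 16 and 26 in the three cases. Light factors
  have at most 14, 5 and 7 letters.
\<close>

lemma light_factors_21:
  "light_factors_ok 2 1 4 15 [(1, 1), (1, 2), (2, 1), (3, 2), (3, 1), (4, 1), (5, 1)]"
  by code_simp

lemma light_factors_12: "light_factors_ok 1 2 4 6 [(1, 1), (2, 1), (3, 1)]"
  by code_simp

lemma light_factors_13: "light_factors_ok 1 3 4 8 [(1, 1), (2, 1), (3, 1), (4, 1)]"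
  by code_simp

text \<open>
  Each exceptional pair does lead to a collision, already within \<open>block g h 5\<close>.
\<close>

lemma collisions_21:
  "\<forall>(x, y)\<in>set [(1, 2), (2, 1), (3, 2), (3, 1), (4, 1), (5, 1)].
     \<not> distinct (prefix_weights (int x) (int y - int 2 * int x) (block 2 1 5))"
  by code_simp

lemma collisions_12:
  "\<forall>(x, y)\<in>set [(2, 1), (3, 1)].
     \<not> distinct (prefix_weights (int x) (int y - int 1 * int x) (block 1 2 5))"
  by code_simp

lemma collisions_13:
  "\<forall>(x, y)\<in>set [(2, 1), (3, 1), (4, 1)].
     \<not> distinct (prefix_weights (int x) (int y - int 1 * int x) (block 1 3 5))"
  by code_simp

text \<open>
  By the linear recurrence, these two counts for each pair determine all later ones.
\<close>

lemma last_visits_21: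
  "map (\<lambda>(x, y). map (last_visits 2 1 (int x) (int y - int 2 * int x) 4) [4, 5])
     [(1, 2), (2, 1), (3, 2), (3, 1), (4, 1), (5, 1)]
   = [[29, 70], [22, 53], [39, 94], [27, 65], [32, 77], [37, 89]]"
  by code_simp

lemma last_visits_12:
  "map (\<lambda>(x, y). map (last_visits 1 2 (int x) (int y - int 1 * int x) 4) [4, 5]) [(2, 1), (3, 1)]
   = [[14, 26], [15, 29]]"
  by code_simp

lemma last_visits_13:
  "map (\<lambda>(x, y). map (last_visits 1 3 (int x) (int y - int 1 * int x) 4) [4, 5])
     [(2, 1), (3, 1), (4, 1)]
   = [[23, 47], [24, 51], [25, 55]]"
  by code_simp

lemma fifth_and_sixth_term:
  assumes "G \<in> rec_seqs g h"
  shows "G 5 = g * (g * (g * G 2 + h * G 1) + h * G 2) + h * (g * G 2 + h * G 1)"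
    and "G 6 = g * G 5 + h * (g * (g * G 2 + h * G 1) + h * G 2)"
proof -
  have rec: "recurrent g h G"
    using assms by (simp add: rec_seqs_def recurrent_def)
  have 3: "G 3 = g * G 2 + h * G 1" and 4: "G 4 = g * G 3 + h * G 2"
    and 5: "G 5 = g * G 4 + h * G 3" and 6: "G 6 = g * G 5 + h * G 4"
    using recurrentD[OF rec, of 0] recurrentD[OF rec, of 1] recurrentD[OF rec, of 2]
      recurrentD[OF rec, of 3] by (simp_all add: eval_nat_numeral)
  show "G 5 = g * (g * (g * G 2 + h * G 1) + h * G 2) + h * (g * G 2 + h * G 1)"
    by (simp only: 3 4 5)
  show "G 6 = g * G 5 + h * (g * (g * G 2 + h * G 1) + h * G 2)"
    by (simp only: 3 4 6)
qed

lemma classification_21: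
  assumes G: "G \<in> rec_seqs 2 1"
    and err: "(\<lambda>X. real (card (represented_upto 2 1 G X)) - p * real X) \<in> O(err 2 1)"
  shows "let I = {(1, 2), (2, 1), (3, 2), (3, 1), (4, 1), (5, 1)} in
    (unique_expansion 2 1 G \<longleftrightarrow> (G 1, G 2) \<notin> I)
    \<and> ((G 1, G 2) \<in> I \<longrightarrow>
         p = 1 \<and> (\<lambda>X. real (card (represented_upto 2 1 G X)) - real X) \<in> O(\<lambda>_. 1))
    \<and> ((G 1, G 2) \<notin> I \<longrightarrow> p = rho 2 1 G)"
proof -
  interpret numeration 2 1 by unfold_locales auto
  let ?I = "[(1, 2), (2, 1), (3, 2), (3, 1), (4, 1), (5, 1)] :: (nat \<times> nat) list"
  have "\<forall>(x, y)\<in>set ?I. coprime x y" by simp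
  note cls = exceptional_classification[OF G density_if_bigo_err[OF err] light_factors_21
      this collisions_21]
  have p1: "p = 1" if I: "(G 1, G 2) \<in> set ?I"
  proof -
    define F where "F = last_visits 2 1 (int (G 1)) (int (G 2) - int 2 * int (G 1)) 4"
    have G56: "G 5 = 5 * G 1 + 12 * G 2" "G 6 = 12 * G 1 + 29 * G 2"
      using fifth_and_sixth_term[OF G] by simp_all
    \<comment> \<open>The counts of last visits agree with \<open>G\<close> at two consecutive indices, so their ratio tends to 1.\<close>
    have "F 4 = G 5 \<and> F 5 = G 6"
      using I last_visits_21 unfolding F_def G56 by auto
    moreover have "\<alpha> * real (G 6) + real (G 5) > 0"
      using G alpha_gt1 by (intro add_pos_pos mult_pos_pos) (auto simp: rec_seqs_def)
    ultimately show ?thesis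
      using cls(3)[OF F_def] by (simp add: eval_nat_numeral)
  qed
  have "sqrt 8 < 4"
    by (rule real_less_lsqrt) simp_all
  then have "\<bar>2 - sqrt 8\<bar> < 2"
    using real_sqrt_gt_zero[of 8] by linarith
  then have "err 2 1 = (\<lambda>_. 1)"
    by (simp add: err_def beta0_def beta_def fun_eq_iff)
  then have "(\<lambda>X. real (card (represented_upto 2 1 G X)) - p * real X) \<in> O(\<lambda>_. 1)"
    using err by simp
  then have bounded: "(\<lambda>X. real (card (represented_upto 2 1 G X)) - real X) \<in> O(\<lambda>_. 1)" if "p = 1"
    unfolding that by simp
  have I: "set ?I = {(1, 2), (2, 1), (3, 2), (3, 1), (4, 1), (5, 1)}"
    by simp
  show ?thesis
    using cls(1,2) p1 bounded unfolding Let_def I by blast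
qed

lemma classification_12:
  assumes G: "G \<in> rec_seqs 1 2"
    and err: "(\<lambda>X. real (card (represented_upto 1 2 G X)) - p * real X) \<in> O(err 1 2)"
  shows "let I = {(2, 1), (3, 1)} in
    (unique_expansion 1 2 G \<longleftrightarrow> (G 1, G 2) \<notin> I)
    \<and> ((G 1, G 2) = (2, 1) \<longrightarrow> p = 5 / 6)
    \<and> ((G 1, G 2) = (3, 1) \<longrightarrow> p = 11 / 16)
    \<and> ((G 1, G 2) \<notin> I \<longrightarrow> p = rho 1 2 G)"
proof -
  interpret numeration 1 2 by unfold_locales auto
  let ?I = "[(2, 1), (3, 1)] :: (nat \<times> nat) list"
  have "\<forall>(x, y)\<in>set ?I. coprime x y" by simp
  note cls = exceptional_classification[OF G density_if_bigo_err[OF err] light_factors_12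
      this collisions_12]
  define F where "F = last_visits 1 2 (int (G 1)) (int (G 2) - int 1 * int (G 1)) 4"
  have G56: "G 5 = 6 * G 1 + 5 * G 2" "G 6 = 10 * G 1 + 11 * G 2"
    using fifth_and_sixth_term[OF G] by simp_all
  have "sqrt 9 = (3 :: real)"
    by (rule real_sqrt_unique) auto
  then have "\<alpha> = 2"
    by (simp add: alpha_def)
  then have p: "p = (2 * real (F 5) + 2 * real (F 4)) / (2 * real (G 6) + 2 * real (G 5))"
    using cls(3)[OF F_def] by (simp add: eval_nat_numeral)
  have p21: "p = 5 / 6" if "(G 1, G 2) = (2, 1)"
    using p that last_visits_12 unfolding F_def G56 by simp
  have p31: "p = 11 / 16" if "(G 1, G 2) = (3, 1)"
    using p that last_visits_12 unfolding F_def G56 by simp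
  have I: "set ?I = {(2, 1), (3, 1)}"
    by simp
  show ?thesis
    using cls(1,2) p21 p31 unfolding Let_def I by blast
qed

lemma classification_13:
  assumes G: "G \<in> rec_seqs 1 3"
    and err: "(\<lambda>X. real (card (represented_upto 1 3 G X)) - p * real X) \<in> O(err 1 3)"
  shows "let I = {(2, 1), (3, 1), (4, 1)} in
    (unique_expansion 1 3 G \<longleftrightarrow> (G 1, G 2) \<notin> I)
    \<and> ((G 1, G 2) = (2, 1) \<longrightarrow>
         p = 1 / 13 * (9 + 2 * omega 1 3) \<and> \<bar>p - 0.7591\<bar> \<le> 0.00005)
    \<and> ((G 1, G 2) = (3, 1) \<longrightarrow>
         p = 1 / 87 * (41 + 25 * omega 1 3) \<and> \<bar>p - 0.5961\<bar> \<le> 0.00005)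
    \<and> ((G 1, G 2) = (4, 1) \<longrightarrow>
         p = 1 / 153 * (55 + 50 * omega 1 3) \<and> \<bar>p - 0.5014\<bar> \<le> 0.00005)
    \<and> ((G 1, G 2) \<notin> I \<longrightarrow> p = rho 1 3 G)"
proof -
  interpret numeration 1 3 by unfold_locales auto
  let ?I = "[(2, 1), (3, 1), (4, 1)] :: (nat \<times> nat) list"
  have "\<forall>(x, y)\<in>set ?I. coprime x y" by simp
  note cls = exceptional_classification[OF G density_if_bigo_err[OF err] light_factors_13
      this collisions_13]
  define F where "F = last_visits 1 3 (int (G 1)) (int (G 2) - int 1 * int (G 1)) 4"
  have p: "p = (\<alpha> * real (F 5) + 3 * real (F 4)) / (\<alpha> * real (G 6) + 3 * real (G 5))"
    using cls(3)[OF F_def] by (simp add: eval_nat_numeral)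
  have G56: "G 5 = 12 * G 1 + 7 * G 2" "G 6 = 21 * G 1 + 19 * G 2"
    using fifth_and_sixth_term[OF G] by simp_all
  have \<alpha>2: "\<alpha> * \<alpha> = \<alpha> + 3"
    using alpha_square by (simp add: power2_eq_square)
  \<comment> \<open>As \<open>\<omega>\<close> is linear in \<open>\<alpha>\<close>, the claimed values of \<open>p\<close> can be compared after clearing denominators.\<close>
  have \<omega>: "omega 1 3 = (\<alpha> - 1) / 3"
    using \<alpha>2 alpha_gt1 by (simp add: omega_def field_simps)
  have "3.60555 < sqrt 13"
    by (rule real_less_rsqrt) (simp add: power2_eq_square)
  moreover have "sqrt 13 < 3.60556"
    by (rule real_less_lsqrt) (simp_all add: power2_eq_square)
  ultimately have \<alpha>: "2.302775 < \<alpha>" "\<alpha> < 2.30278"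
    by (auto simp: alpha_def)
  have p21: "p = 1 / 13 * (9 + 2 * omega 1 3) \<and> \<bar>p - 0.7591\<bar> \<le> 0.00005"
    if "(G 1, G 2) = (2, 1)"
  proof -
    have "p = (47 * \<alpha> + 69) / (61 * \<alpha> + 93)"
      using p that last_visits_13 unfolding F_def G56 by (simp add: mult.commute)
    also have "\<dots> = 1 / 13 * (9 + 2 * omega 1 3)"
      using \<alpha>2 \<alpha> unfolding \<omega> by (simp add: field_simps)
    finally have eq: "p = 1 / 13 * (9 + 2 * omega 1 3)" .
    with \<alpha> have "\<bar>p - 0.7591\<bar> \<le> 0.00005"
      unfolding \<omega> by (simp add: abs_le_iff field_simps)
    with eq show ?thesis ..
  qed
  have p31: "p = 1 / 87 * (41 + 25 * omega 1 3) \<and> \<bar>p - 0.5961\<bar> \<le> 0.00005"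
    if "(G 1, G 2) = (3, 1)"
  proof -
    have "p = (51 * \<alpha> + 72) / (82 * \<alpha> + 129)"
      using p that last_visits_13 unfolding F_def G56 by (simp add: mult.commute)
    also have "\<dots> = 1 / 87 * (41 + 25 * omega 1 3)"
      using \<alpha>2 \<alpha> unfolding \<omega> by (simp add: field_simps)
    finally have eq: "p = 1 / 87 * (41 + 25 * omega 1 3)" .
    with \<alpha> have "\<bar>p - 0.5961\<bar> \<le> 0.00005"
      unfolding \<omega> by (simp add: abs_le_iff field_simps)
    with eq show ?thesis ..
  qed
  have p41: "p = 1 / 153 * (55 + 50 * omega 1 3) \<and> \<bar>p - 0.5014\<bar> \<le> 0.00005"
    if "(G 1, G 2) = (4, 1)"
  proof -
    have "p = (55 * \<alpha> + 75) / (103 * \<alpha> + 165)"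
      using p that last_visits_13 unfolding F_def G56 by (simp add: mult.commute)
    also have "\<dots> = 1 / 153 * (55 + 50 * omega 1 3)"
      using \<alpha>2 \<alpha> unfolding \<omega> by (simp add: field_simps)
    finally have eq: "p = 1 / 153 * (55 + 50 * omega 1 3)" .
    with \<alpha> have "\<bar>p - 0.5014\<bar> \<le> 0.00005"
      unfolding \<omega> by (simp add: abs_le_iff field_simps)
    with eq show ?thesis ..
  qed
  have I: "set ?I = {(2, 1), (3, 1), (4, 1)}"
    by simp
  show ?thesis
    using cls(1,2) p21 p31 p41 unfolding Let_def I by (intro conjI impI) simp_all
qed

theorem theorem2p14:
  fixes g h :: nat and G :: "nat \<Rightarrow> nat" and p :: real
  assumes "g \<ge> 1" and "h \<ge> 1"
    and "G \<in> rec_seqs g h"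
    and "(\<lambda>X. real (card (represented_upto g h G X)) - p * real X) \<in> O(err g h)"
  shows "(\<lambda>X. real (card (represented_upto g h G X)) / real X) \<longlonglongrightarrow> p
    \<and> ((g, h) = (2, 1) \<longrightarrow>
        (let I = {(1, 2), (2, 1), (3, 2), (3, 1), (4, 1), (5, 1)} in
          (unique_expansion g h G \<longleftrightarrow> (G 1, G 2) \<notin> I)
          \<and> ((G 1, G 2) \<in> I \<longrightarrow>
               p = 1 \<and> (\<lambda>X. real (card (represented_upto g h G X)) - real X) \<in> O(\<lambda>_. 1))
          \<and> ((G 1, G 2) \<notin> I \<longrightarrow> p = rho g h G)))
    \<and> ((g, h) = (1, 2) \<longrightarrow>
        (let I = {(2, 1), (3, 1)} in
          (unique_expansion g h G \<longleftrightarrow> (G 1, G 2) \<notin> I)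
          \<and> ((G 1, G 2) = (2, 1) \<longrightarrow> p = 5 / 6)
          \<and> ((G 1, G 2) = (3, 1) \<longrightarrow> p = 11 / 16)
          \<and> ((G 1, G 2) \<notin> I \<longrightarrow> p = rho g h G)))
    \<and> ((g, h) = (1, 3) \<longrightarrow>
        (let I = {(2, 1), (3, 1), (4, 1)} in
          (unique_expansion g h G \<longleftrightarrow> (G 1, G 2) \<notin> I)
          \<and> ((G 1, G 2) = (2, 1) \<longrightarrow>
               p = 1 / 13 * (9 + 2 * omega g h) \<and> \<bar>p - 0.7591\<bar> \<le> 0.00005)
          \<and> ((G 1, G 2) = (3, 1) \<longrightarrow>
               p = 1 / 87 * (41 + 25 * omega g h) \<and> \<bar>p - 0.5961\<bar> \<le> 0.00005)
          \<and> ((G 1, G 2) = (4, 1) \<longrightarrow>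
               p = 1 / 153 * (55 + 50 * omega g h) \<and> \<bar>p - 0.5014\<bar> \<le> 0.00005)
          \<and> ((G 1, G 2) \<notin> I \<longrightarrow> p = rho g h G)))"
proof -
  interpret numeration g h
    using assms(1,2) by unfold_locales
  show ?thesis
  proof (intro conjI impI, goal_cases)
    case 1
    show ?case by (rule density_if_bigo_err[OF assms(4)])
  next
    case 2
    then have gh: "g = 2" "h = 1" by simp_all
    show ?case
      unfolding gh by (rule classification_21[OF assms(3,4)[unfolded gh]])
  next
    case 3
    then have gh: "g = 1" "h = 2" by simp_all
    show ?case
      unfolding gh by (rule classification_12[OF assms(3,4)[unfolded gh]])
  next
    case 4
    then have gh: "g = 1" "h = 3" by simp_all
    show ?case
      unfolding gh by (rule classification_13[OF assms(3,4)[unfolded gh]])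
  qed
qed

end
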